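(* Let $D_n$ be $n$ i.i.d. samples from the non-parametric regression model $y=m(x)+\varepsilon$, where $x\sim\mathcal D_x$ on $\{0,1\}^d$, $m(x)\in[-1/2,1/2]$, $\varepsilon\sim\mathcal E$, $\mathbb E[\varepsilon]=0$, $\varepsilon\in[-1/2,1/2]$. Let $S_n$ be the set of splits chosen by the Level Split Algorithm (see context) with honesty flag $h=0$, and let $m_n(\cdot;S_n)$ be its output estimator. Let $\delta\in(0,1)$. Then: 1. If $\bar V$ is $C$-approximate submodular, $m$ is $r$-sparse, and the input number of splits is $\log(t)=\frac{C r}{C r+2}\left(\log(n)-\log(\log(d/\delta))\right)$, then $$\mathbb P_{D_n\sim\mathcal D^n}\left(\mathbb E_{x\sim\mathcal D_x}\left[(m(x)-m_n(x;S_n))^2\right]>\tilde\Omega\left(C\, r\left(\frac{\log(d/\delta)}{n}\right)^{1/(C r+2)}\right)\right)\le\delta .$$ 2. If $\bar V$ is $C$-approximate submodular, the features are independent (i.e. $\mathcal D_x$ is a product of Bernoulli distributions), $m$ is $r$-sparse, and $\log(t)=r$, then $$\mathbb P_{D_n\sim\mathcal D^n}\left(\mathbb E_{x\sim\mathcal D_x}\left[(m(x)-m_n(x;S_n))^2\right]>\tilde\Omega\left(C\sqrt{\frac{2^r\log(d/\delta)}{n}}\right)\right)\le\delta .$$ 3. If $m$ is $(\beta,r)$-strongly sparse, $n\ge\tilde\Omega\left(\frac{2^r\log(d/\delta)}{\beta^2}\right)$, and $\log(t)=r$, then $$\mathbb P_{D_n\sim\mathcal D^n}\left(\mathbb E_{x\sim\mathcal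 D_x}\left[(m(x)-m_n(x;S_n))^2\right]>\tilde\Omega\left(\frac{2^r\log(d/\delta)\log(n)}{n}\right)\right)\le\delta .$$
   Context: **Model.** $D_n=\{(x^{(i)},y^{(i)})\}_{i=1}^n$ is i.i.d. from $\mathcal D$: $x^{(i)}$ is drawn from a distribution $\mathcal D_x$ with support $\{0,1\}^d$, $\varepsilon^{(i)}\in[-1/2,1/2]$ is drawn from a zero-mean distribution $\mathcal E$, and $y^{(i)}=m(x^{(i)})+\varepsilon^{(i)}$ with $m:\{0,1\}^d\to[-1/2,1/2]$. For $S\subseteq[d]$, $x_S$ is the sub-vector of $x$ with coordinates in $S$. **Sparsity.** $m$ is $r$-sparse if there is $R\subseteq[d]$, $|R|=r$ (the relevant features), and $h_0:\{0,1\}^r\to\mathbb R$ with $m(z)=h_0(z_R)$ for all $z$. **Heterogeneity.** $\bar V(S)=\mathbb E_{z\sim\mathcal D_x}\left[\left(\mathbb E_{w\sim\mathcal D_x}[m(w)\mid w_S=z_S]\right)^2\right]$ for $S\subseteq[d]$. **$C$-approximate submodularity** ($C\ge1$): $\bar V(T\cup\{i\})-\bar V(T)\le C(\bar V(S\cup\{i\})-\bar V(S))$ for all $S\subseteq T\subseteq[d]$ and $i\in[d]$. **$(\beta,r)$-strong sparsity:** $m$ is $r$-sparse with relevant features $R$, and $\bar V(T\cup\{j\})-\bar V(T)+\beta\le\bar V(T\cup\{i\})-\bar V(T)$ for all $i\in R$, $j\in[d]\setminus R$, $T\subset[d]\setminus\{i\}$. **Level Split Algorithm** (inputs: $\log t$,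 $D_n$, honesty flag $h$; here $h=0$). Let $V_n(S)=\frac1n\sum_{j\in[n]}a_j(S)^2$, where $a_j(S)$ is the average of $y^{(k)}$ over all $k\in[n]$ with $x^{(k)}_S=x^{(j)}_S$. Start with $S=\emptyset$, $\mathcal P_0=\{\{0,1\}^d\}$, $\mathrm{level}=-1$. While $\mathrm{level}<\log t$: increase $\mathrm{level}$ by one; select $i\in[d]$ maximizing $V_n(S\cup\{i\})$ (ties broken randomly); for every $A\in\mathcal P_{\mathrm{level}}$ let $A^i_k=\{x\in A: x_i=k\}$, $k=0,1$; if each of $A_0^i,A_1^i$ contains at least one $x^{(j)}$, put both into $\mathcal P_{\mathrm{level}+1}$, otherwise put $A$ into $\mathcal P_{\mathrm{level}+1}$; set $S\leftarrow S\cup\{i\}$. Output the final partition $\mathcal P_n$, the final set $S_n=S$, and the estimator $m_n(x;S_n)$ equal to the average of $y^{(j)}$ over the training points $x^{(j)}$ lying in the cell $\mathcal P_n(x)$ of $\mathcal P_n$ containing $x$. **Conventions.** $\log$ is base 2. $\tilde\Omega(a)$ denotes a quantity of the form $K\cdot a\cdot L$ with $K$ a universal constant and $L$ a suitable factor polylogarithmic in $n,2^r,C,1/\beta$; so "$\mathbb P(X>\tilde\Omega(a))\le\delta$" means that $X$ exceeds such a threshold with probability at most $\delta$, and "$n\ge\tilde\Omega(a)$" means $n$ is at least such a quantity.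
   Formalization: The claim fails in some corners, so the formal version also assumes: d/δ ≥ 2 (drops d=1 with δ>1/2); r ≥ 1 in part 1 (threshold is 0 at r=0); r < d in part 3 (strong sparsity is vacuous at r=d); β ≤ 1 in part 3. *)

theory Defs
  imports "HOL-Probability.Probability"
begin

text \<open>
  A point of $\{0,1\}^d$ is a Boolean list of length \<open>d\<close> (\<open>True\<close> is 1), the index sets $[d]$ and $[n]$
  are \<open>{..<d}\<close> and \<open>{..<n}\<close>, and the sub-vector $x_S$ is \<open>nths x S\<close>.
\<close>

definition cube :: "nat \<Rightarrow> bool list set" where
  "cube d = {x. length x = d}"

definition regression_model ::
    "nat \<Rightarrow> bool list pmf \<Rightarrow> real measure \<Rightarrow> (bool list \<Rightarrow> real) \<Rightarrow> bool" where
  "regression_model d Dx E m \<longleftrightarrow>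
     set_pmf Dx \<subseteq> cube d \<and>
     (\<forall>x\<in>cube d. m x \<in> {-1/2..1/2}) \<and>
     prob_space E \<and> sets E = sets borel \<and>
     (AE e in E. e \<in> {-1/2..1/2}) \<and> (\<integral>e. e \<partial>E) = 0"

type_synonym sample = "nat \<Rightarrow> bool list \<times> real"

definition observation_law ::
    "bool list pmf \<Rightarrow> real measure \<Rightarrow> (bool list \<Rightarrow> real) \<Rightarrow> (bool list \<times> real) measure" where
  "observation_law Dx E m =
     distr (measure_pmf Dx \<Otimes>\<^sub>M E) (count_space UNIV \<Otimes>\<^sub>M borel) (\<lambda>(x, e). (x, m x + e))"

definition sample_law ::
    "nat \<Rightarrow> bool list pmf \<Rightarrow> real measure \<Rightarrow> (bool list \<Rightarrow> real) \<Rightarrow> sample measure" where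
  "sample_law n Dx E m = PiM {..<n} (\<lambda>_. observation_law Dx E m)"

definition independent_features :: "nat \<Rightarrow> bool list pmf \<Rightarrow> bool" where
  "independent_features d Dx \<longleftrightarrow>
     prob_space.indep_vars (measure_pmf Dx) (\<lambda>_. count_space UNIV) (\<lambda>i x. x ! i) {..<d}"

definition relevant_features :: "nat \<Rightarrow> nat \<Rightarrow> (bool list \<Rightarrow> real) \<Rightarrow> nat set \<Rightarrow> bool" where
  "relevant_features d r m R \<longleftrightarrow>
     R \<subseteq> {..<d} \<and> card R = r \<and> (\<exists>h :: bool list \<Rightarrow> real. \<forall>z\<in>cube d. m z = h (nths z R))"

definition r_sparse :: "nat \<Rightarrow> nat \<Rightarrow> (bool list \<Rightarrow> real) \<Rightarrow> bool" where
  "r_sparse d r m \<longleftrightarrow> (\<exists>R. relevant_features d r m R)"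

definition Vbar :: "bool list pmf \<Rightarrow> (bool list \<Rightarrow> real) \<Rightarrow> nat set \<Rightarrow> real" where
  "Vbar Dx m S = measure_pmf.expectation Dx (\<lambda>z.
     (measure_pmf.expectation (cond_pmf Dx {w. nths w S = nths z S}) m)\<^sup>2)"

definition approx_submodular :: "nat \<Rightarrow> real \<Rightarrow> (nat set \<Rightarrow> real) \<Rightarrow> bool" where
  "approx_submodular d C V \<longleftrightarrow>
     (\<forall>S T i. S \<subseteq> T \<and> T \<subseteq> {..<d} \<and> i \<in> {..<d} \<longrightarrow>
        V (T \<union> {i}) - V T \<le> C * (V (S \<union> {i}) - V S))"

definition strongly_sparse ::
    "nat \<Rightarrow> real \<Rightarrow> nat \<Rightarrow> bool list pmf \<Rightarrow> (bool list \<Rightarrow> real) \<Rightarrow> bool" where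
  "strongly_sparse d \<beta> r Dx m \<longleftrightarrow>
     (\<exists>R. relevant_features d r m R \<and>
        (\<forall>i\<in>R. \<forall>j\<in>{..<d} - R. \<forall>T. T \<subset> {..<d} - {i} \<longrightarrow>
           Vbar Dx m (T \<union> {j}) - Vbar Dx m T + \<beta> \<le> Vbar Dx m (T \<union> {i}) - Vbar Dx m T))"

definition average :: "sample \<Rightarrow> nat set \<Rightarrow> real" where
  "average D J = (\<Sum>k\<in>J. snd (D k)) / card J"

definition Vn :: "nat \<Rightarrow> sample \<Rightarrow> nat set \<Rightarrow> real" where
  "Vn n D S =
     (\<Sum>j<n. (average D {k\<in>{..<n}. nths (fst (D k)) S = nths (fst (D j)) S})\<^sup>2) / n"

definition best_splits :: "nat \<Rightarrow> nat \<Rightarrow> sample \<Rightarrow> nat set \<Rightarrow> nat set" where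
  "best_splits d n D S =
     {i\<in>{..<d}. \<forall>j\<in>{..<d}. Vn n D (S \<union> {j}) \<le> Vn n D (S \<union> {i})}"

definition split_cell ::
    "nat \<Rightarrow> sample \<Rightarrow> nat \<Rightarrow> bool list set \<Rightarrow> bool list set set" where
  "split_cell n D i A =
     (let cell = (\<lambda>k. {x\<in>A. x ! i = k}) in
      if (\<exists>j<n. fst (D j) \<in> cell False) \<and> (\<exists>j<n. fst (D j) \<in> cell True)
      then {cell False, cell True} else {A})"

text \<open>
  The while loop of the Level Split Algorithm, from a state consisting of the level, the chosen set \<open>S\<close>
  and the current partition \<open>P\<close>. Its result is a distribution because ties are broken uniformly at
  random. The loop guard precedes the increment and the level starts at \<open>-1\<close>, so an integer input
  \<open>logt = r\<close> gives \<open>r + 1\<close> iterations; \<open>logt\<close> may be any real number.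
\<close>

function level_split_loop ::
    "nat \<Rightarrow> nat \<Rightarrow> real \<Rightarrow> sample \<Rightarrow> int \<Rightarrow> nat set \<Rightarrow> bool list set set
       \<Rightarrow> (bool list set set \<times> nat set) pmf" where
  "level_split_loop d n logt D level S P =
     (if real_of_int level < logt then
        bind_pmf (pmf_of_set (best_splits d n D S)) (\<lambda>i.
          level_split_loop d n logt D (level + 1) (S \<union> {i}) (\<Union>A\<in>P. split_cell n D i A))
      else return_pmf (P, S))"
  by auto
termination
  by (relation "Wellfounded.measure (\<lambda>(d, n, logt, D, level, S, P). nat (\<lceil>logt\<rceil> - level))")
     (auto simp: less_ceiling_iff)

declare level_split_loop.simps [simp del]

definition level_split ::
    "nat \<Rightarrow> nat \<Rightarrow> real \<Rightarrow> sample \<Rightarrow> (bool list set set \<times> nat set) pmf" where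
  "level_split d n logt D = level_split_loop d n logt D (-1) {} {cube d}"

definition estimator :: "nat \<Rightarrow> sample \<Rightarrow> bool list set set \<Rightarrow> bool list \<Rightarrow> real" where
  "estimator n D P x = average D {j\<in>{..<n}. fst (D j) \<in> (THE A. A \<in> P \<and> x \<in> A)}"

definition mse :: "bool list pmf \<Rightarrow> (bool list \<Rightarrow> real) \<Rightarrow> (bool list \<Rightarrow> real) \<Rightarrow> real" where
  "mse Dx m f = measure_pmf.expectation Dx (\<lambda>x. (m x - f x)\<^sup>2)"

text \<open>
  The probability, over the sample and the tie-breaking, that the mean squared error of the output
  estimator exceeds \<open>\<tau>\<close>.
\<close>

definition prob_mse_exceeds ::
    "nat \<Rightarrow> nat \<Rightarrow> real \<Rightarrow> bool list pmf \<Rightarrow> real measure \<Rightarrow> (bool list \<Rightarrow> real) \<Rightarrow> real \<Rightarrow> real" where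
  "prob_mse_exceeds d n logt Dx E m \<tau> =
     (\<integral>D. measure_pmf.prob (level_split d n logt D)
            {(P, S). mse Dx m (estimator n D P) > \<tau>} \<partial>sample_law n Dx E m)"

text \<open>
  $\tilde\Omega(a)$ with universal constants \<open>K\<close> and \<open>p\<close>: for quantities \<open>zs\<close> that are at least 1, every
  factor polylogarithmic in \<open>zs\<close> is bounded by a constant multiple of \<open>polylog p zs\<close> for some \<open>p\<close>.
\<close>

definition polylog :: "nat \<Rightarrow> real list \<Rightarrow> real" where
  "polylog p zs = (1 + (\<Sum>z\<leftarrow>zs. log 2 z)) ^ p"

definition Omega_tilde :: "real \<Rightarrow> nat \<Rightarrow> real list \<Rightarrow> real \<Rightarrow> real" where
  "Omega_tilde K p zs a = K * a * polylog p zs"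

end

theory Submission
  imports Defs
begin

text \<open>
  For every feature set \<open>S\<close> and every leaf (the points with a given sub-vector $x_S$), Bernstein's
  inequality controls the empirical mass of the leaf and the empirical moment of \<open>y\<close> on it, with a
  deviation $2\sqrt{\eta(p+\eta)}$, where \<open>p\<close> is the true mass of the leaf; a union bound makes this simultaneous
  over all \<open>S\<close> with at most \<open>s\<close> elements for \<open>\<eta>\<close> of order $s\log(d/\delta)/n$. On this event
  $V_n$ and $\bar V$ differ by $O(\sqrt{2^s\eta})$, and each leaf contributes at most $O(\eta)$ to the
  mean squared error beyond its bias: a leaf of mass $O(\eta)$, in particular an empty one, contributes at
  most its mass, and on a heavier leaf the average of \<open>y\<close> is accurate. So the error is at most
  $\mathbb E[m^2]-\bar V(S_n)+O(2^s\eta)$. It remains to bound the gap $\mathbb E[m^2]-\bar V(S)$ along the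
  greedy run. By submodularity a step shrinks it by the factor $1-1/(Cr)$; under independence an
  irrelevant feature has gain zero, so selecting one forces the gap to be small; under strong sparsity no
  irrelevant feature is selected before all relevant ones.
\<close>

section \<open>Bernstein inequality\<close>

text \<open>With h = 0 the same sample chooses the splits and forms the averages, so the final
  \<open>S\<close> depends on the data. This is why the concentration is uniform over all small
  feature sets; on the good event everything else is deterministic and covers every tie-break. Two
  orders of error appear. Comparing V_n with Vbar is first order: deviations of size sqrt(\<eta> p),
  summed over 2^s leaves, give sqrt(2^s \<eta>), and this controls the choice of splits. Averaging
  inside a leaf is second order: a mean off by about sqrt(\<eta> / p), squared and weighted by p,
  costs \<eta> whatever p is. Hence claims 1 and 2 have square-root rates, while claim 3, where the
  gap ends exactly at zero, keeps only 2^r \<eta> up to logarithms. A further obstacle is that a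
  split with an empty side is refused: the cells are not the leaves of \<open>S\<close> and match
  them only as far as sample points can tell, so on a leaf without samples the estimate is merely
  bounded.\<close>

lemma exp_le_quadratic:
  fixes u :: real
  assumes "\<bar>u\<bar> \<le> 1"
  shows "exp u \<le> 1 + u + u\<^sup>2"
proof (cases "u \<ge> 0")
  case True
  then show ?thesis using exp_bound[of u] assms by simp
next
  case False
  \<comment> \<open>For negative u both sides are compared after multiplying by the positive 1 - u:
    the left becomes at most 1, the right becomes 1 - u^3.\<close>
  have "exp u * (1 - u) \<le> exp u * exp (- u)"
    using exp_ge_add_one_self[of "-u"] by (intro mult_left_mono) auto
  also have "\<dots> = 1" by (simp flip: exp_add)
  also have "1 \<le> (1 + u + u\<^sup>2) * (1 - u)"
  proof -
    have "(1 + u + u\<^sup>2) * (1 - u) = 1 - u * u * u" by (simp add: algebra_simps power2_eq_square)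
    moreover have "u * u * u \<le> 0"
      using False by (simp add: mult_nonneg_nonpos)
    ultimately show ?thesis by simp
  qed
  finally show ?thesis using False by (simp add: mult_le_cancel_right)
qed

text \<open>Both Bernstein regimes in one formula: of order sqrt(\<eta> p) for p \<ge> \<eta>, of
  order \<eta> for lighter leaves.\<close>

definition deviation :: "real \<Rightarrow> real \<Rightarrow> real" where
  "deviation \<eta> p = 2 * sqrt (\<eta> * (p + \<eta>))"

text \<open>\<open>f\<close> is left uncentred, so p bounds the raw second moment. For a function
  bounded by 1 that vanishes off a leaf this moment is at most the mass of the leaf, which is the p
  of every application.\<close>

lemma bernstein_mgf:
  fixes f :: "'a \<Rightarrow> real"
  assumes "prob_space M" and [measurable]: "f \<in> borel_measurable M"
    and bdd: "AE x in M. \<bar>f x\<bar> \<le> 1" and second: "(\<integral>x. (f x)\<^sup>2 \<partial>M) \<le> p"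
    and \<theta>: "0 \<le> \<theta>" "\<theta> \<le> 1"
  shows "integrable M (\<lambda>x. exp (\<theta> * f x))"
    and "(\<integral>x. exp (\<theta> * f x) \<partial>M) \<le> exp (\<theta> * (\<integral>x. f x \<partial>M) + \<theta>\<^sup>2 * p)"
proof -
  interpret prob_space M by fact
  have small: "AE x in M. \<bar>\<theta> * f x\<bar> \<le> 1"
    using bdd by eventually_elim (use \<theta> in \<open>auto simp: abs_mult mult_le_one\<close>)
  show int: "integrable M (\<lambda>x. exp (\<theta> * f x))"
    by (rule integrable_const_bound[where B = "exp 1"]) (use small in auto)
  have intf: "integrable M f"
    by (rule integrable_const_bound[where B = 1]) (use bdd in auto)
  have intf2: "integrable M (\<lambda>x. (f x)\<^sup>2)"
    by (rule integrable_const_bound[where B = 1]) (use bdd in \<open>auto simp: abs_square_le_1\<close>)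
  have "(\<integral>x. exp (\<theta> * f x) \<partial>M) \<le> (\<integral>x. 1 + \<theta> * f x + \<theta>\<^sup>2 * (f x)\<^sup>2 \<partial>M)"
  proof (rule integral_mono_AE[OF int])
    show "integrable M (\<lambda>x. 1 + \<theta> * f x + \<theta>\<^sup>2 * (f x)\<^sup>2)" using intf intf2 by auto
    show "AE x in M. exp (\<theta> * f x) \<le> 1 + \<theta> * f x + \<theta>\<^sup>2 * (f x)\<^sup>2"
      using small by eventually_elim (use exp_le_quadratic in \<open>force simp: power_mult_distrib\<close>)
  qed
  also have "\<dots> = 1 + \<theta> * (\<integral>x. f x \<partial>M) + \<theta>\<^sup>2 * (\<integral>x. (f x)\<^sup>2 \<partial>M)"
    using intf intf2 by (simp add: prob_space)
  also have "\<dots> \<le> 1 + (\<theta> * (\<integral>x. f x \<partial>M) + \<theta>\<^sup>2 * p)"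
    using mult_left_mono[OF second, of "\<theta>\<^sup>2"] by simp
  also have "\<dots> \<le> exp (\<theta> * (\<integral>x. f x \<partial>M) + \<theta>\<^sup>2 * p)"
    by (rule exp_ge_add_one_self)
  finally show "(\<integral>x. exp (\<theta> * f x) \<partial>M) \<le> exp (\<theta> * (\<integral>x. f x \<partial>M) + \<theta>\<^sup>2 * p)" .
qed

lemma bernstein_upper:
  fixes f :: "'a \<Rightarrow> real" and n :: nat and \<eta> p :: real
  assumes M: "prob_space M" and [measurable]: "f \<in> borel_measurable M"
    and bdd: "AE x in M. \<bar>f x\<bar> \<le> 1" and second: "(\<integral>x. (f x)\<^sup>2 \<partial>M) \<le> p"
    and "0 \<le> p" "0 < \<eta>" 
  shows "measure (PiM {..<n} (\<lambda>_. M))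
           {D \<in> space (PiM {..<n} (\<lambda>_. M)). (\<Sum>k<n. f (D k)) \<ge> n * ((\<integral>x. f x \<partial>M) + deviation \<eta> p)}
         \<le> exp (- (n * \<eta>))"
proof -
  \<comment> \<open>The minimiser of $\theta(p+\eta)+\eta/\theta$; unlike $\sqrt{\eta/p}$ it never exceeds 1.\<close>
  define \<theta> where "\<theta> = sqrt (\<eta> / (p + \<eta>))"
  define \<mu> where "\<mu> = (\<integral>x. f x \<partial>M)"
  let ?P = "PiM {..<n} (\<lambda>_. M)"
  interpret M: prob_space M by fact
  interpret PM: product_sigma_finite "\<lambda>_. M" by standard
  interpret P: prob_space ?P by (intro prob_space_PiM M)
  have \<theta>: "0 < \<theta>" "\<theta> \<le> 1" using assms by (auto simp: \<theta>_def)
  have opt: "\<theta>\<^sup>2 * p - \<theta> * deviation \<eta> p \<le> - \<eta>"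
  proof -
    have sq: "\<theta>\<^sup>2 = \<eta> / (p + \<eta>)" using assms by (simp add: \<theta>_def)
    have "\<theta> * sqrt (\<eta> * (p + \<eta>)) = sqrt ((\<eta> / (p + \<eta>)) * (\<eta> * (p + \<eta>)))"
      unfolding \<theta>_def by (rule real_sqrt_mult[symmetric])
    also have "\<dots> = sqrt (\<eta>\<^sup>2)" using assms by (simp add: power2_eq_square)
    also have "\<dots> = \<eta>" using assms by simp
    finally have "\<theta> * deviation \<eta> p = 2 * \<eta>" by (simp add: deviation_def)
    moreover have "\<theta>\<^sup>2 * p \<le> \<eta>" unfolding sq using assms by (simp add: field_simps)
    ultimately show ?thesis by simp
  qed
  have expand: "exp (\<theta> * (\<Sum>k<n. f (D k))) = (\<Prod>k<n. exp (\<theta> * f (D k)))" for D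
    by (simp add: sum_distrib_left exp_sum)
  note mgf = bernstein_mgf[OF M assms(2) bdd second less_imp_le[OF \<theta>(1)] \<theta>(2)]
  have int: "integrable ?P (\<lambda>D. exp (\<theta> * (\<Sum>k<n. f (D k))))"
    unfolding expand by (rule PM.product_integrable_prod) (auto intro: mgf)
  have "measure ?P {D \<in> space ?P. (\<Sum>k<n. f (D k)) \<ge> n * (\<mu> + deviation \<eta> p)}
      \<le> exp (- \<theta> * (n * (\<mu> + deviation \<eta> p))) * (\<integral>D\<in>space ?P. exp (\<theta> * (\<Sum>k<n. f (D k))) \<partial>?P)"
    by (rule P.Chernoff_ineq_ge[OF \<theta>(1)]) (use integrable_mult_indicator[OF sets.top int] in \<open>auto simp: set_integrable_def\<close>)
  also have "(\<integral>D\<in>space ?P. exp (\<theta> * (\<Sum>k<n. f (D k))) \<partial>?P) = (\<integral>D. (\<Prod>k<n. exp (\<theta> * f (D k))) \<partial>?P)"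
    unfolding set_lebesgue_integral_def expand[symmetric] by (rule Bochner_Integration.integral_cong) auto
  also have "\<dots> = (\<Prod>k<n. (\<integral>x. exp (\<theta> * f x) \<partial>M))"
    by (rule PM.product_integral_prod) (auto intro: mgf)
  also have "\<dots> \<le> (\<Prod>k<n. exp (\<theta> * \<mu> + \<theta>\<^sup>2 * p))"
    by (rule prod_mono) (use mgf(2) in \<open>auto simp: \<mu>_def intro!: integral_nonneg\<close>)
  also have "\<dots> = exp (n * (\<theta> * \<mu> + \<theta>\<^sup>2 * p))" by (simp add: exp_of_nat_mult)
  also have "exp (- \<theta> * (n * (\<mu> + deviation \<eta> p))) * \<dots> = exp (n * (\<theta>\<^sup>2 * p - \<theta> * deviation \<eta> p))"
    by (simp add: algebra_simps flip: exp_add)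
  also have "\<dots> \<le> exp (- (n * \<eta>))"
    using mult_left_mono[OF opt, of "real n"] by simp
  finally show ?thesis by (simp add: \<mu>_def)
qed

lemma bernstein:
  fixes f :: "'a \<Rightarrow> real" and n :: nat and \<eta> p :: real
  assumes M: "prob_space M" and [measurable]: "f \<in> borel_measurable M"
    and bdd: "AE x in M. \<bar>f x\<bar> \<le> 1" and second: "(\<integral>x. (f x)\<^sup>2 \<partial>M) \<le> p"
    and "0 \<le> p" "0 < \<eta>" "0 < n"
  shows "measure (PiM {..<n} (\<lambda>_. M))
           {D \<in> space (PiM {..<n} (\<lambda>_. M)). \<bar>(\<Sum>k<n. f (D k)) / n - (\<integral>x. f x \<partial>M)\<bar> \<ge> deviation \<eta> p}
         \<le> 2 * exp (- (n * \<eta>))" (is "measure ?P ?B \<le> _")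
proof -
  let ?B1 = "{D \<in> space ?P. (\<Sum>k<n. f (D k)) \<ge> n * ((\<integral>x. f x \<partial>M) + deviation \<eta> p)}"
  let ?B2 = "{D \<in> space ?P. (\<Sum>k<n. - f (D k)) \<ge> n * ((\<integral>x. - f x \<partial>M) + deviation \<eta> p)}"
  interpret P: prob_space ?P by (intro prob_space_PiM M)
  have "?B \<subseteq> ?B1 \<union> ?B2"
    using \<open>0 < n\<close> by (auto simp: field_simps sum_negf abs_if split: if_splits)
  then have "measure ?P ?B \<le> measure ?P (?B1 \<union> ?B2)"
    by (rule P.finite_measure_mono) measurable
  also have "\<dots> \<le> measure ?P ?B1 + measure ?P ?B2"
    by (rule measure_Un_le) measurable
  also have "\<dots> \<le> exp (- (n * \<eta>)) + exp (- (n * \<eta>))"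
    using assms by (intro add_mono bernstein_upper) auto
  finally show ?thesis by simp
qed

section \<open>Leaves of the cube and heterogeneity\<close>

lemma finite_cube [simp]: "finite (cube d)"
  using finite_lists_length_eq[of "UNIV :: bool set" d] by (simp add: cube_def)

lemma nths_conv_map: "nths xs A = map ((!) xs) (filter (\<lambda>i. i \<in> A) [0..<length xs])"
proof -
  have "zip xs [0..<length xs] = map (\<lambda>i. (xs ! i, i)) [0..<length xs]"
    by (rule nth_equalityI) auto
  then show ?thesis by (simp add: nths_def filter_map comp_def)
qed

lemma nths_eq_iff:
  assumes "x \<in> cube d" "z \<in> cube d" "S \<subseteq> {..<d}"
  shows "nths x S = nths z S \<longleftrightarrow> (\<forall>i\<in>S. x ! i = z ! i)"
  using assms by (auto simp: nths_conv_map cube_def)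

text \<open>All potential values of x_S, including those of mass zero or without samples; there the
  quotient of moment by mass is 0 / 0 = 0.\<close>

definition patterns :: "nat set \<Rightarrow> bool list set" where
  "patterns S = {v. length v = card S}"

lemma finite_patterns [simp]: "finite (patterns S)"
  using finite_lists_length_eq[of "UNIV :: bool set" "card S"] by (simp add: patterns_def)

lemma card_patterns: "card (patterns S) = 2 ^ card S"
  using card_lists_length_eq[of "UNIV :: bool set" "card S"] by (simp add: patterns_def)

lemma nths_in_patterns: "x \<in> cube d \<Longrightarrow> S \<subseteq> {..<d} \<Longrightarrow> nths x S \<in> patterns S"
  by (auto simp: patterns_def cube_def length_nths intro!: arg_cong[where f = card])

definition leaf :: "nat \<Rightarrow> nat set \<Rightarrow> bool list \<Rightarrow> bool list set" where
  "leaf d S v = {x \<in> cube d. nths x S = v}"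

definition sample_leaf :: "nat \<Rightarrow> sample \<Rightarrow> nat set \<Rightarrow> bool list \<Rightarrow> nat set" where
  "sample_leaf n D S v = {k \<in> {..<n}. nths (fst (D k)) S = v}"

definition mass :: "nat \<Rightarrow> bool list pmf \<Rightarrow> nat set \<Rightarrow> bool list \<Rightarrow> real" where
  "mass d Dx S v = (\<Sum>x\<in>leaf d S v. pmf Dx x)"

definition moment :: "nat \<Rightarrow> bool list pmf \<Rightarrow> (bool list \<Rightarrow> real) \<Rightarrow> nat set \<Rightarrow> bool list \<Rightarrow> real" where
  "moment d Dx m S v = (\<Sum>x\<in>leaf d S v. pmf Dx x * m x)"

definition emp_mass :: "nat \<Rightarrow> sample \<Rightarrow> nat set \<Rightarrow> bool list \<Rightarrow> real" where
  "emp_mass n D S v = card (sample_leaf n D S v) / n"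

definition emp_moment :: "nat \<Rightarrow> sample \<Rightarrow> nat set \<Rightarrow> bool list \<Rightarrow> real" where
  "emp_moment n D S v = (\<Sum>k\<in>sample_leaf n D S v. snd (D k)) / n"

lemma finite_leaf [simp]: "finite (leaf d S v)"
  by (simp add: leaf_def)

lemma finite_sample_leaf [simp]: "finite (sample_leaf n D S v)"
  by (simp add: sample_leaf_def)

lemma sum_leaves:
  fixes g :: "bool list \<Rightarrow> real"
  assumes "S \<subseteq> {..<d}"
  shows "(\<Sum>x\<in>cube d. g x) = (\<Sum>v\<in>patterns S. \<Sum>x\<in>leaf d S v. g x)"
  unfolding leaf_def using assms
  by (subst sum.group) (auto simp: nths_in_patterns)

lemma sum_sample_leaves:
  fixes g :: "nat \<Rightarrow> real"
  assumes "S \<subseteq> {..<d}" "\<And>k. k < n \<Longrightarrow> fst (D k) \<in> cube d"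
  shows "(\<Sum>k<n. g k) = (\<Sum>v\<in>patterns S. \<Sum>k\<in>sample_leaf n D S v. g k)"
  unfolding sample_leaf_def using assms
  by (subst sum.group) (auto intro: nths_in_patterns)

lemma average_sample_leaf:
  "n > 0 \<Longrightarrow> average D (sample_leaf n D S v) = emp_moment n D S v / emp_mass n D S v"
  by (simp add: average_def emp_moment_def emp_mass_def)

lemma abs_average_le_1:
  assumes "\<And>k. k \<in> J \<Longrightarrow> \<bar>snd (D k)\<bar> \<le> 1" "finite J"
  shows "\<bar>average D J\<bar> \<le> 1"
proof (cases "J = {}")
  case False
  have "\<bar>\<Sum>k\<in>J. snd (D k)\<bar> \<le> (\<Sum>k\<in>J. 1)"
    by (rule order_trans[OF sum_abs]) (rule sum_mono, use assms in auto)
  then show ?thesis using False assms by (simp add: average_def card_gt_0_iff)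
qed (simp add: average_def)

lemma abs_emp_moment_le:
  assumes "\<And>k. k < n \<Longrightarrow> \<bar>snd (D k)\<bar> \<le> 1"
  shows "\<bar>emp_moment n D S v\<bar> \<le> emp_mass n D S v"
proof -
  have "\<bar>\<Sum>k\<in>sample_leaf n D S v. snd (D k)\<bar> \<le> (\<Sum>k\<in>sample_leaf n D S v. 1)"
    by (rule order_trans[OF sum_abs]) (rule sum_mono, use assms in \<open>auto simp: sample_leaf_def\<close>)
  then show ?thesis by (simp add: emp_moment_def emp_mass_def divide_right_mono)
qed

text \<open>A leaf of empirical mass p and moment q holds n p samples, each contributing (q / p)^2.
  The result has the shape of \<open>Vbar_conv_leaves\<close>, so that the two heterogeneities can
  be compared leaf by leaf.\<close>

lemma Vn_conv_leaves:
  assumes "S \<subseteq> {..<d}" "\<And>k. k < n \<Longrightarrow> fst (D k) \<in> cube d" "n > 0"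
  shows "Vn n D S = (\<Sum>v\<in>patterns S. (emp_moment n D S v)\<^sup>2 / emp_mass n D S v)"
proof -
  have "Vn n D S = (\<Sum>j<n. (average D (sample_leaf n D S (nths (fst (D j)) S)))\<^sup>2) / n"
    by (simp add: Vn_def sample_leaf_def)
  also have "\<dots> = (\<Sum>v\<in>patterns S. \<Sum>j\<in>sample_leaf n D S v.
                   (average D (sample_leaf n D S (nths (fst (D j)) S)))\<^sup>2) / n"
    by (subst sum_sample_leaves[OF assms(1,2)]) auto
  also have "\<dots> = (\<Sum>v\<in>patterns S. \<Sum>j\<in>sample_leaf n D S v. (average D (sample_leaf n D S v))\<^sup>2) / n"
    by (intro arg_cong2[where f = "(/)"] sum.cong refl) (auto simp: sample_leaf_def)
  also have "\<dots> = (\<Sum>v\<in>patterns S. emp_mass n D S v * (average D (sample_leaf n D S v))\<^sup>2)"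
    by (simp add: emp_mass_def sum_divide_distrib)
  also have "\<dots> = (\<Sum>v\<in>patterns S. (emp_moment n D S v)\<^sup>2 / emp_mass n D S v)"
    using assms by (intro sum.cong refl) (simp add: average_sample_leaf power2_eq_square)
  finally show ?thesis .
qed

text \<open>The idea is the variational formula $q^2/p=\max_f\,(2fq-f^2p)$, attained at some $|f|\le 1$.\<close>

lemma square_ratio_diff_le:
  fixes p p' q q' :: real
  assumes "\<bar>q\<bar> \<le> p" "\<bar>q'\<bar> \<le> p'"
  shows "q'\<^sup>2 / p' - q\<^sup>2 / p \<le> 2 * \<bar>q' - q\<bar> + \<bar>p' - p\<bar>"
proof -
  define f where "f = q' / p'"
  have f: "\<bar>f\<bar> \<le> 1" using assms by (auto simp: f_def divide_le_eq_1)
  have "q'\<^sup>2 / p' = 2 * f * q' - f\<^sup>2 * p'"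
    by (cases "p' = 0") (auto simp: f_def power2_eq_square)
  moreover have "q\<^sup>2 / p \<ge> 2 * f * q - f\<^sup>2 * p"
  proof (cases "p = 0")
    case False
    then have "p > 0" using assms by auto
    have "q\<^sup>2 / p - (2 * f * q - f\<^sup>2 * p) = p * (f - q / p)\<^sup>2"
      using \<open>p > 0\<close> by (simp add: field_simps power2_eq_square)
    also have "\<dots> \<ge> 0" using \<open>p > 0\<close> by simp
    finally show ?thesis by simp
  qed (use assms in auto)
  ultimately have "q'\<^sup>2 / p' - q\<^sup>2 / p \<le> 2 * (f * (q' - q)) + - (f\<^sup>2 * (p' - p))"
    by (simp add: algebra_simps)
  also have "f * (q' - q) \<le> \<bar>q' - q\<bar>"
    using mult_right_mono[OF f, of "\<bar>q' - q\<bar>"] by (simp flip: abs_mult)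
  also have "- (f\<^sup>2 * (p' - p)) \<le> \<bar>f\<^sup>2 * (p' - p)\<bar>" by simp
  also have "\<dots> \<le> \<bar>p' - p\<bar>"
    using mult_right_mono[of "f\<^sup>2" 1 "\<bar>p' - p\<bar>"] f by (simp add: abs_mult abs_square_le_1)
  finally show ?thesis by simp
qed

text \<open>AM-GM trades the square root for a bound linear in p, so that a sum over leaves can use
  that the masses add up to 1. The parameter \<theta> is free for balancing the two terms.\<close>

lemma deviation_le:
  assumes "0 < \<eta>" "0 \<le> p" "0 < \<theta>"
  shows "deviation \<eta> p \<le> \<eta> / \<theta> + \<theta> * (p + \<eta>)"
proof -
  have "sqrt ((\<eta> / \<theta>) * (\<theta> * (p + \<eta>))) \<le> (\<eta> / \<theta> + \<theta> * (p + \<eta>)) / 2"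
    using assms by (intro arith_geo_mean_sqrt) auto
  then show ?thesis using assms by (simp add: deviation_def)
qed

section \<open>Population side: leaf means and the gap\<close>

locale feature_model =
  fixes d :: nat and Dx :: "bool list pmf" and m :: "bool list \<Rightarrow> real"
  assumes support: "set_pmf Dx \<subseteq> cube d"
    and m_bounded: "\<And>x. x \<in> cube d \<Longrightarrow> \<bar>m x\<bar> \<le> 1 / 2"
begin

lemma expectation_conv_sum: "measure_pmf.expectation Dx f = (\<Sum>x\<in>cube d. pmf Dx x * (f x :: real))"
  using support by (subst integral_measure_pmf_real[where A = "cube d"]) (auto simp: mult.commute)

lemma mass_nonneg: "0 \<le> mass d Dx S v"
  by (simp add: mass_def sum_nonneg)

lemma mass_conv_prob: "mass d Dx S v = measure_pmf.prob Dx {w. nths w S = v}"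
proof -
  have "measure_pmf.prob Dx {w. nths w S = v} = measure_pmf.expectation Dx (indicator {w. nths w S = v})"
    by simp
  also have "\<dots> = (\<Sum>x\<in>cube d. pmf Dx x * indicator {w. nths w S = v} x)"
    by (rule expectation_conv_sum)
  also have "\<dots> = mass d Dx S v"
    unfolding mass_def leaf_def by (rule sum.mono_neutral_cong_right) auto
  finally show ?thesis by simp
qed

lemma sum_mass: "S \<subseteq> {..<d} \<Longrightarrow> (\<Sum>v\<in>patterns S. mass d Dx S v) = 1"
  using sum_leaves[of S d "pmf Dx"] sum_pmf_eq_1[OF finite_cube support] by (simp add: mass_def)

lemma abs_moment_le: "\<bar>moment d Dx m S v\<bar> \<le> mass d Dx S v"
proof -
  have "\<bar>moment d Dx m S v\<bar> \<le> (\<Sum>x\<in>leaf d S v. \<bar>pmf Dx x * m x\<bar>)"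
    unfolding moment_def by (rule sum_abs)
  also have "\<dots> \<le> mass d Dx S v"
    unfolding mass_def
  proof (rule sum_mono)
    fix x assume "x \<in> leaf d S v"
    then have "\<bar>m x\<bar> \<le> 1" using m_bounded[of x] by (auto simp: leaf_def)
    then show "\<bar>pmf Dx x * m x\<bar> \<le> pmf Dx x" by (simp add: abs_mult mult_left_le)
  qed
  finally show ?thesis .
qed

definition leaf_mean :: "nat set \<Rightarrow> bool list \<Rightarrow> real" where
  "leaf_mean S v = moment d Dx m S v / mass d Dx S v"

lemma cond_expectation:
  assumes "z \<in> set_pmf Dx"
  shows "measure_pmf.expectation (cond_pmf Dx {w. nths w S = nths z S}) m = leaf_mean S (nths z S)"
proof -
  let ?A = "{w. nths w S = nths z S}"
  have ne: "set_pmf Dx \<inter> ?A \<noteq> {}" using assms by auto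
  have "measure_pmf.expectation (cond_pmf Dx ?A) m = (\<Sum>x\<in>cube d. m x * pmf (cond_pmf Dx ?A) x)"
    using support by (intro integral_measure_pmf_real) (auto simp: set_cond_pmf[OF ne])
  also have "\<dots> = (\<Sum>x\<in>leaf d S (nths z S). pmf Dx x * m x / mass d Dx S (nths z S))"
    unfolding leaf_def
    by (rule sum.mono_neutral_cong_right) (auto simp: pmf_cond[OF ne] mass_conv_prob)
  finally show ?thesis by (simp add: leaf_mean_def moment_def sum_divide_distrib)
qed

text \<open>For z outside the support the conditioning event may be null and \<open>cond_pmf\<close>
  unspecified, but such z carry weight 0.\<close>

lemma Vbar_conv_sum: "Vbar Dx m S = (\<Sum>z\<in>cube d. pmf Dx z * (leaf_mean S (nths z S))\<^sup>2)"
  unfolding Vbar_def expectation_conv_sum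
  by (intro sum.cong refl) (metis cond_expectation mult_eq_0_iff set_pmf_iff)

lemma Vbar_conv_leaves:
  assumes "S \<subseteq> {..<d}"
  shows "Vbar Dx m S = (\<Sum>v\<in>patterns S. (moment d Dx m S v)\<^sup>2 / mass d Dx S v)"
proof -
  have "Vbar Dx m S = (\<Sum>v\<in>patterns S. \<Sum>z\<in>leaf d S v. pmf Dx z * (leaf_mean S (nths z S))\<^sup>2)"
    unfolding Vbar_conv_sum by (rule sum_leaves[OF assms])
  also have "\<dots> = (\<Sum>v\<in>patterns S. \<Sum>z\<in>leaf d S v. pmf Dx z * (leaf_mean S v)\<^sup>2)"
    by (intro sum.cong refl) (auto simp: leaf_def)
  also have "\<dots> = (\<Sum>v\<in>patterns S. mass d Dx S v * (leaf_mean S v)\<^sup>2)"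
    by (simp add: mass_def sum_distrib_right)
  also have "\<dots> = (\<Sum>v\<in>patterns S. (moment d Dx m S v)\<^sup>2 / mass d Dx S v)"
    by (intro sum.cong refl) (simp add: leaf_mean_def power2_eq_square)
  finally show ?thesis .
qed

text \<open>The expected conditional variance of m given x_S (see \<open>gap_conv_error\<close>),
  that is, the bias left after splitting on \<open>S\<close>. Its differences are those of
  \<open>Vbar\<close> with the sign reversed.\<close>

definition gap :: "nat set \<Rightarrow> real" where
  "gap S = (\<Sum>x\<in>cube d. pmf Dx x * (m x)\<^sup>2) - Vbar Dx m S"

text \<open>Bias-variance decomposition on one leaf for an arbitrary prediction c. On a leaf of mass
  zero the moment vanishes as well, by \<open>abs_moment_le\<close>, and the quotients are
  0.\<close>

lemma leaf_square_error:
  "(\<Sum>x\<in>leaf d S v. pmf Dx x * (m x - c)\<^sup>2)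
     = (\<Sum>x\<in>leaf d S v. pmf Dx x * (m x)\<^sup>2) - (moment d Dx m S v)\<^sup>2 / mass d Dx S v
       + mass d Dx S v * (c - leaf_mean S v)\<^sup>2"
proof -
  have "(\<Sum>x\<in>leaf d S v. pmf Dx x * (m x - c)\<^sup>2)
     = (\<Sum>x\<in>leaf d S v. pmf Dx x * (m x)\<^sup>2 - 2 * c * (pmf Dx x * m x) + c\<^sup>2 * pmf Dx x)"
    by (intro sum.cong refl) (simp add: power2_eq_square algebra_simps)
  also have "\<dots> = (\<Sum>x\<in>leaf d S v. pmf Dx x * (m x)\<^sup>2) - 2 * c * moment d Dx m S v + c\<^sup>2 * mass d Dx S v"
    by (simp add: sum.distrib sum_subtractf moment_def mass_def sum_distrib_left)
  moreover have "- 2 * c * moment d Dx m S v + c\<^sup>2 * mass d Dx S v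
      = - ((moment d Dx m S v)\<^sup>2 / mass d Dx S v) + mass d Dx S v * (c - leaf_mean S v)\<^sup>2"
    using abs_moment_le[of S v]
    by (cases "mass d Dx S v = 0") (auto simp: leaf_mean_def field_simps power2_eq_square)
  ultimately show ?thesis by simp
qed

lemma gap_conv_leaves:
  assumes "S \<subseteq> {..<d}"
  shows "gap S = (\<Sum>v\<in>patterns S.
      (\<Sum>x\<in>leaf d S v. pmf Dx x * (m x)\<^sup>2) - (moment d Dx m S v)\<^sup>2 / mass d Dx S v)"
  unfolding gap_def Vbar_conv_leaves[OF assms] sum_leaves[OF assms, of "\<lambda>x. pmf Dx x * (m x)\<^sup>2"]
  by (simp add: sum_subtractf)

lemma leaf_gap_nonneg:
  "0 \<le> (\<Sum>x\<in>leaf d S v. pmf Dx x * (m x)\<^sup>2) - (moment d Dx m S v)\<^sup>2 / mass d Dx S v"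
proof -
  have "0 \<le> (\<Sum>x\<in>leaf d S v. pmf Dx x * (m x - leaf_mean S v)\<^sup>2)"
    by (intro sum_nonneg) simp
  then show ?thesis by (simp add: leaf_square_error)
qed

lemma gap_nonneg: "S \<subseteq> {..<d} \<Longrightarrow> 0 \<le> gap S"
  unfolding gap_conv_leaves by (intro sum_nonneg leaf_gap_nonneg)

lemma gap_conv_error:
  assumes "S \<subseteq> {..<d}"
  shows "gap S = (\<Sum>x\<in>cube d. pmf Dx x * (m x - leaf_mean S (nths x S))\<^sup>2)"
proof -
  have "(\<Sum>x\<in>leaf d S v. pmf Dx x * (m x - leaf_mean S (nths x S))\<^sup>2)
      = (\<Sum>x\<in>leaf d S v. pmf Dx x * (m x - leaf_mean S v)\<^sup>2)" for v
    by (intro sum.cong refl) (auto simp: leaf_def)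
  then show ?thesis
    unfolding sum_leaves[OF assms, of "\<lambda>x. pmf Dx x * (m x - leaf_mean S (nths x S))\<^sup>2"]
    by (simp add: gap_conv_leaves[OF assms] leaf_square_error)
qed

text \<open>The conditional mean is the least-squares optimum among functions of x_S. Different
  competitors g give monotonicity of the gap (the mean for a smaller set), the bound 1/4 (zero) and
  vanishing once all relevant features are present (m itself).\<close>

lemma gap_le_error:
  assumes "S \<subseteq> {..<d}"
    and "\<And>x z. x \<in> cube d \<Longrightarrow> z \<in> cube d \<Longrightarrow> nths x S = nths z S \<Longrightarrow> g x = g z"
  shows "gap S \<le> (\<Sum>x\<in>cube d. pmf Dx x * (m x - g x)\<^sup>2)"
  unfolding sum_leaves[OF assms(1), of "\<lambda>x. pmf Dx x * (m x - g x)\<^sup>2"] gap_conv_leaves[OF assms(1)]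
proof (rule sum_mono)
  fix v
  obtain c where c: "\<And>x. x \<in> leaf d S v \<Longrightarrow> g x = c"
    using assms(2) by (metis (mono_tags, lifting) leaf_def mem_Collect_eq)
  have "(\<Sum>x\<in>leaf d S v. pmf Dx x * (m x)\<^sup>2) - (moment d Dx m S v)\<^sup>2 / mass d Dx S v
      \<le> (\<Sum>x\<in>leaf d S v. pmf Dx x * (m x - c)\<^sup>2)"
    by (simp add: leaf_square_error mass_nonneg)
  also have "\<dots> = (\<Sum>x\<in>leaf d S v. pmf Dx x * (m x - g x)\<^sup>2)"
    by (intro sum.cong refl) (simp add: c)
  finally show "(\<Sum>x\<in>leaf d S v. pmf Dx x * (m x)\<^sup>2) - (moment d Dx m S v)\<^sup>2 / mass d Dx S v
      \<le> (\<Sum>x\<in>leaf d S v. pmf Dx x * (m x - g x)\<^sup>2)" .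
qed

lemma gap_antimono:
  assumes "S \<subseteq> T" "T \<subseteq> {..<d}"
  shows "gap T \<le> gap S"
proof -
  have S: "S \<subseteq> {..<d}" using assms by auto
  show ?thesis
    unfolding gap_conv_error[OF S]
  proof (rule gap_le_error[OF assms(2)])
    fix x z assume "x \<in> cube d" "z \<in> cube d" "nths x T = nths z T"
    then have "nths x S = nths z S" using assms S by (auto simp: nths_eq_iff)
    then show "leaf_mean S (nths x S) = leaf_mean S (nths z S)" by simp
  qed
qed

lemma gap_le_quarter:
  assumes "S \<subseteq> {..<d}"
  shows "gap S \<le> 1 / 4"
proof -
  have "gap S \<le> (\<Sum>x\<in>cube d. pmf Dx x * (m x - 0)\<^sup>2)"
    by (rule gap_le_error[OF assms]) simp
  also have "\<dots> \<le> (\<Sum>x\<in>cube d. pmf Dx x * (1 / 4))"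
  proof (intro sum_mono mult_left_mono)
    fix x assume "x \<in> cube d"
    then have "\<bar>m x\<bar>\<^sup>2 \<le> (1 / 2)\<^sup>2" by (intro power_mono m_bounded) auto
    then show "(m x - 0)\<^sup>2 \<le> 1 / 4" by (simp add: power2_eq_square)
  qed simp
  also have "\<dots> = 1 / 4"
    using sum_pmf_eq_1[OF finite_cube support] by (simp flip: sum_divide_distrib)
  finally show ?thesis .
qed

lemma relevant_feature_eq:
  assumes "relevant_features d r m R" "x \<in> cube d" "z \<in> cube d" "\<And>i. i \<in> R \<Longrightarrow> x ! i = z ! i"
  shows "m x = m z"
proof -
  from assms(1) obtain h where R: "R \<subseteq> {..<d}" and h: "\<forall>z\<in>cube d. m z = h (nths z R)"
    unfolding relevant_features_def by auto
  have "nths x R = nths z R" using assms R by (auto simp: nths_eq_iff)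
  then show ?thesis using h assms by simp
qed

lemma gap_relevant:
  assumes "relevant_features d r m R" "R \<subseteq> T" "T \<subseteq> {..<d}"
  shows "gap T = 0"
proof -
  have "gap T \<le> (\<Sum>x\<in>cube d. pmf Dx x * (m x - m x)\<^sup>2)"
  proof (rule gap_le_error[OF assms(3)])
    fix x z assume xz: "x \<in> cube d" "z \<in> cube d" "nths x T = nths z T"
    then show "m x = m z"
      using assms by (intro relevant_feature_eq[OF assms(1)]) (auto simp: nths_eq_iff)
  qed
  then show ?thesis using gap_nonneg[OF assms(3)] by simp
qed

text \<open>By \<open>square_ratio_diff_le\<close> a leaf costs two moment deviations and one mass
  deviation, hence the factor 3; the balancing parameter sqrt N then gives 3 (1 + 2) sqrt N.
  \<open>N\<close> is kept apart from 2^|S| \<eta> so that one accuracy serves all sets of size at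
  most s.\<close>

lemma Vn_close:
  assumes S: "S \<subseteq> {..<d}" and "n > 0" "0 < \<eta>" and small: "2 ^ card S * \<eta> \<le> N" "N \<le> 1"
    and D: "\<And>k. k < n \<Longrightarrow> fst (D k) \<in> cube d" "\<And>k. k < n \<Longrightarrow> \<bar>snd (D k)\<bar> \<le> 1"
    and dev: "\<And>v. v \<in> patterns S \<Longrightarrow> \<bar>emp_mass n D S v - mass d Dx S v\<bar> \<le> deviation \<eta> (mass d Dx S v)"
      "\<And>v. v \<in> patterns S \<Longrightarrow> \<bar>emp_moment n D S v - moment d Dx m S v\<bar> \<le> deviation \<eta> (mass d Dx S v)"
  shows "\<bar>Vn n D S - Vbar Dx m S\<bar> \<le> 9 * sqrt N"
proof -
  have "0 < N" using assms(3) small by (metis less_le_trans mult_pos_pos zero_less_numeral zero_less_power)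
  have diff: "\<bar>(emp_moment n D S v)\<^sup>2 / emp_mass n D S v - (moment d Dx m S v)\<^sup>2 / mass d Dx S v\<bar>
      \<le> 3 * deviation \<eta> (mass d Dx S v)" if "v \<in> patterns S" for v
  proof -
    have emp: "\<bar>emp_moment n D S v\<bar> \<le> emp_mass n D S v" by (intro abs_emp_moment_le D)
    show ?thesis
      using square_ratio_diff_le[OF abs_moment_le[of S v] emp]
        square_ratio_diff_le[OF emp abs_moment_le[of S v]] dev[OF that]
        abs_minus_commute[of "moment d Dx m S v" "emp_moment n D S v"]
        abs_minus_commute[of "mass d Dx S v" "emp_mass n D S v"]
      by (intro abs_leI) linarith+
  qed
  have "\<bar>Vn n D S - Vbar Dx m S\<bar>
      = \<bar>\<Sum>v\<in>patterns S. (emp_moment n D S v)\<^sup>2 / emp_mass n D S v - (moment d Dx m S v)\<^sup>2 / mass d Dx S v\<bar>"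
    using assms by (simp add: Vn_conv_leaves Vbar_conv_leaves sum_subtractf)
  also have "\<dots> \<le> (\<Sum>v\<in>patterns S. 3 * deviation \<eta> (mass d Dx S v))"
    by (rule order_trans[OF sum_abs]) (intro sum_mono diff)
  also have "\<dots> \<le> (\<Sum>v\<in>patterns S. 3 * (\<eta> / sqrt N + sqrt N * (mass d Dx S v + \<eta>)))"
    using assms \<open>0 < N\<close> by (intro sum_mono mult_left_mono deviation_le mass_nonneg) auto
  also have "\<dots> = 3 * (2 ^ card S * \<eta> / sqrt N + sqrt N * (1 + 2 ^ card S * \<eta>))"
    by (simp add: sum.distrib card_patterns sum_mass[OF S] flip: sum_distrib_left)
  also have "\<dots> \<le> 3 * (N / sqrt N + sqrt N * (1 + 1))"
    using assms \<open>0 < N\<close> by (intro mult_left_mono add_mono divide_right_mono) auto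
  also have "\<dots> = 9 * sqrt N" using \<open>0 < N\<close> by (simp add: real_div_sqrt)
  finally show ?thesis .
qed

text \<open>The prediction is prescribed only on leaves that contain samples; elsewhere only its
  size is known. The deviation bounds force a leaf without samples to be light, hence cheap.\<close>

lemma error_le_gap:
  assumes S: "S \<subseteq> {..<d}" and "n > 0" "0 < \<eta>"
    and D: "\<And>k. k < n \<Longrightarrow> \<bar>snd (D k)\<bar> \<le> 1"
    and dev: "\<And>v. v \<in> patterns S \<Longrightarrow> \<bar>emp_mass n D S v - mass d Dx S v\<bar> \<le> deviation \<eta> (mass d Dx S v)"
      "\<And>v. v \<in> patterns S \<Longrightarrow> \<bar>emp_moment n D S v - moment d Dx m S v\<bar> \<le> deviation \<eta> (mass d Dx S v)"
    and f: "\<And>x. x \<in> cube d \<Longrightarrow> \<bar>f x\<bar> \<le> 1"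
      "\<And>v x. v \<in> patterns S \<Longrightarrow> x \<in> leaf d S v \<Longrightarrow> emp_mass n D S v > 0
         \<Longrightarrow> f x = emp_moment n D S v / emp_mass n D S v"
  shows "mse Dx m f \<le> gap S + 72 * 2 ^ card S * \<eta>"
proof -
  have leaf_le: "(\<Sum>x\<in>leaf d S v. pmf Dx x * (m x - f x)\<^sup>2)
      \<le> ((\<Sum>x\<in>leaf d S v. pmf Dx x * (m x)\<^sup>2) - (moment d Dx m S v)\<^sup>2 / mass d Dx S v) + 72 * \<eta>"
    (is "?L \<le> ?G + _") if v: "v \<in> patterns S" for v
  proof -
    define p q p' q' where "p = mass d Dx S v" and "q = moment d Dx m S v"
      and "p' = emp_mass n D S v" and "q' = emp_moment n D S v"
    note defs = p_def q_def p'_def q'_def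
    show ?thesis
    \<comment> \<open>On a light leaf the squared error is at most (1/2 + 1)^2 = 9/4, and 9/4 * 32 =
      72 sets the constant. Above the threshold the deviation e is at most p / 2, so the empirical
      mass stays comparable to p; the cost there is at most 66 \<eta>.\<close>
    proof (cases "p \<le> 32 * \<eta>")
      case True
      have "?L \<le> (\<Sum>x\<in>leaf d S v. pmf Dx x * (9 / 4))"
      proof (intro sum_mono mult_left_mono)
        fix x assume "x \<in> leaf d S v"
        then have "\<bar>m x\<bar> \<le> 1 / 2" "\<bar>f x\<bar> \<le> 1" using m_bounded f by (auto simp: leaf_def)
        then have "\<bar>m x - f x\<bar> \<le> 3 / 2" by linarith
        then have "\<bar>m x - f x\<bar>\<^sup>2 \<le> (3 / 2)\<^sup>2" by (intro power_mono) auto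
        then show "(m x - f x)\<^sup>2 \<le> 9 / 4" by (simp add: power2_eq_square)
      qed simp
      also have "\<dots> = 9 / 4 * p" by (simp add: defs mass_def mult.commute flip: sum_distrib_right sum_divide_distrib)
      also have "\<dots> \<le> ?G + 72 * \<eta>" using True leaf_gap_nonneg[of S v] by simp
      finally show ?thesis .
    next
      case False
      then have p: "p > 32 * \<eta>" "p > 0" using \<open>0 < \<eta>\<close> by auto
      define e where "e = deviation \<eta> p"
      have e2: "e\<^sup>2 = 4 * (\<eta> * (p + \<eta>))"
        using assms p by (simp add: e_def deviation_def power_mult_distrib)
      have e2': "e\<^sup>2 \<le> p\<^sup>2 * (33 / 256)"
      proof -
        have "\<eta> * (p + \<eta>) \<le> (p / 32) * (p + p / 32)"
          using p assms by (intro mult_mono) auto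
        then show ?thesis unfolding e2 by (simp add: power2_eq_square)
      qed
      have "e\<^sup>2 \<le> p\<^sup>2 / 4" using e2' zero_le_power2[of p] by linarith
      then have "e\<^sup>2 \<le> (p / 2)\<^sup>2" by (simp add: power_divide)
      then have e: "e \<le> p / 2" using p by (simp add: power2_le_iff_abs_le abs_le_iff)
      have d1: "\<bar>p' - p\<bar> \<le> e" and d2: "\<bar>q' - q\<bar> \<le> e"
        using dev[OF v] by (auto simp: defs e_def)
      have p': "p' \<ge> p / 2" using d1 e by linarith
      then have "p' > 0" using p by simp
      have q: "\<bar>q\<bar> \<le> p" using abs_moment_le by (simp add: defs)
      \<comment> \<open>Over the common denominator p' only the two deviations remain, the second
        one weighted by q / p, whose size is at most 1.\<close>
      have "q' / p' - q / p = ((q' - q) + (q / p) * (p - p')) / p'"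
        using p \<open>p' > 0\<close> by (simp add: field_simps)
      moreover have "\<bar>(q' - q) + (q / p) * (p - p')\<bar> \<le> e + 1 * e"
      proof (intro order_trans[OF abs_triangle_ineq] add_mono d2)
        show "\<bar>q / p * (p - p')\<bar> \<le> 1 * e"
          unfolding abs_mult using q p d1 by (intro mult_mono) (auto simp: divide_le_eq_1)
      qed
      ultimately have "\<bar>q' / p' - q / p\<bar> \<le> 2 * e / p'"
        using \<open>p' > 0\<close> by (simp add: divide_right_mono)
      also have "\<dots> \<le> 2 * e / (p / 2)"
        using p' p d1 by (intro divide_left_mono) auto
      finally have "\<bar>q' / p' - q / p\<bar>\<^sup>2 \<le> (2 * e / (p / 2))\<^sup>2"
        by (intro power_mono) auto
      also have "\<dots> = 16 * e\<^sup>2 / p\<^sup>2" by (simp add: power2_eq_square)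
      finally have "p * (q' / p' - q / p)\<^sup>2 \<le> p * (16 * e\<^sup>2 / p\<^sup>2)"
        using p by (intro mult_left_mono) auto
      also have "\<dots> = 64 * \<eta> * (p + \<eta>) / p" unfolding e2 using p by (simp add: power2_eq_square)
      also have "\<dots> \<le> 72 * \<eta>"
      proof -
        have "64 * \<eta> * (p + \<eta>) \<le> 64 * \<eta> * (p + p / 32)"
          using p assms by (intro mult_left_mono) auto
        also have "\<dots> \<le> 72 * \<eta> * p" using p assms by (simp add: algebra_simps)
        finally show ?thesis using p by (simp add: pos_divide_le_eq)
      qed
      finally have *: "p * (q' / p' - q / p)\<^sup>2 \<le> 72 * \<eta>" .
      have "?L = (\<Sum>x\<in>leaf d S v. pmf Dx x * (m x - q' / p')\<^sup>2)"
        using f(2)[OF v] \<open>p' > 0\<close> by (intro sum.cong refl) (auto simp: defs)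
      also have "\<dots> = ?G + p * (q' / p' - q / p)\<^sup>2"
        by (simp add: leaf_square_error defs leaf_mean_def)
      finally show ?thesis using * by simp
    qed
  qed
  have "mse Dx m f = (\<Sum>v\<in>patterns S. \<Sum>x\<in>leaf d S v. pmf Dx x * (m x - f x)\<^sup>2)"
    unfolding mse_def expectation_conv_sum by (rule sum_leaves[OF S])
  also have "\<dots> \<le> (\<Sum>v\<in>patterns S.
      ((\<Sum>x\<in>leaf d S v. pmf Dx x * (m x)\<^sup>2) - (moment d Dx m S v)\<^sup>2 / mass d Dx S v) + 72 * \<eta>)"
    by (intro sum_mono leaf_le)
  also have "\<dots> = gap S + 72 * 2 ^ card S * \<eta>"
    by (subst sum.distrib) (simp add: gap_conv_leaves[OF S] card_patterns)
  finally show ?thesis .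
qed

section \<open>Independent features: an irrelevant split gains nothing\<close>

lemma prob_conv_sum: "measure_pmf.prob Dx A = (\<Sum>x\<in>cube d. pmf Dx x * indicator A x)"
  using expectation_conv_sum[of "indicator A"] by simp

lemma prob_agree:
  assumes "independent_features d Dx" "J \<subseteq> {..<d}"
  shows "measure_pmf.prob Dx {w. \<forall>j\<in>J. w ! j = z j} = (\<Prod>j\<in>J. measure_pmf.prob Dx {w. w ! j = z j})"
proof (cases "J = {}")
  case False
  have "measure_pmf.prob Dx (\<Inter>j\<in>J. (\<lambda>x. x ! j) -` {z j} \<inter> space (measure_pmf Dx))
      = (\<Prod>j\<in>J. measure_pmf.prob Dx ((\<lambda>x. x ! j) -` {z j} \<inter> space (measure_pmf Dx)))"
    using assms False finite_subset[OF assms(2)]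
    by (intro prob_space.indep_varsD[OF prob_space_measure_pmf, where M' = "\<lambda>_. count_space UNIV" and I = "{..<d}"])
       (auto simp: independent_features_def)
  moreover have "(\<Inter>j\<in>J. (\<lambda>x. x ! j) -` {z j} \<inter> space (measure_pmf Dx)) = {w. \<forall>j\<in>J. w ! j = z j}"
    using False by auto
  ultimately show ?thesis by (simp add: vimage_def)
qed simp

text \<open>On a leaf of \<open>U\<close> the function is constant, and requiring x_i = b prescribes
  one more coordinate, so by independence the probability of the leaf acquires exactly one more
  factor.\<close>

lemma independent_feature_factor:
  assumes indep: "independent_features d Dx" and U: "U \<subseteq> {..<d}" "i < d" "i \<notin> U"
    and F: "\<And>x z. x \<in> cube d \<Longrightarrow> z \<in> cube d \<Longrightarrow> nths x U = nths z U \<Longrightarrow> F x = F z"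
  shows "(\<Sum>x\<in>cube d. pmf Dx x * (F x * indicator {w. w ! i = b} x))
       = (\<Sum>x\<in>cube d. pmf Dx x * F x) * measure_pmf.prob Dx {w. w ! i = b}"
proof -
  have "(\<Sum>x\<in>leaf d U v. pmf Dx x * (F x * indicator {w. w ! i = b} x))
      = (\<Sum>x\<in>leaf d U v. pmf Dx x * F x) * measure_pmf.prob Dx {w. w ! i = b}" for v
  proof (cases "leaf d U v = {}")
    case False
    then obtain z where z: "z \<in> cube d" "nths z U = v" by (auto simp: leaf_def)
    have const: "F x = F z" if "x \<in> leaf d U v" for x
      using that z by (intro F) (auto simp: leaf_def)
    have leaf_eq: "leaf d U v = {x \<in> cube d. \<forall>j\<in>U. x ! j = z ! j}"
      using z U by (auto simp: leaf_def nths_eq_iff)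
    define z' where "z' = (\<lambda>j. if j = i then b else z ! j)"
    have "(\<Sum>x\<in>leaf d U v. pmf Dx x * indicator {w. w ! i = b} x)
        = (\<Sum>x\<in>cube d. pmf Dx x * indicator {w. \<forall>j\<in>insert i U. w ! j = z' j} x)"
      unfolding leaf_eq using U by (intro sum.mono_neutral_cong_left) (auto simp: z'_def indicator_def)
    also have "\<dots> = measure_pmf.prob Dx {w. w ! i = b} * (\<Prod>j\<in>U. measure_pmf.prob Dx {w. w ! j = z ! j})"
      unfolding prob_conv_sum[symmetric] using U finite_subset[OF U(1)]
      by (subst prob_agree[OF indep]) (auto simp: z'_def intro!: prod.cong)
    also have "(\<Prod>j\<in>U. measure_pmf.prob Dx {w. w ! j = z ! j})
        = (\<Sum>x\<in>cube d. pmf Dx x * indicator {w. \<forall>j\<in>U. w ! j = z ! j} x)"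
      unfolding prob_conv_sum[symmetric] using U by (subst prob_agree[OF indep]) auto
    also have "\<dots> = (\<Sum>x\<in>leaf d U v. pmf Dx x)"
      unfolding leaf_eq by (intro sum.mono_neutral_cong_right) auto
    finally have *: "(\<Sum>x\<in>leaf d U v. pmf Dx x * indicator {w. w ! i = b} x)
        = measure_pmf.prob Dx {w. w ! i = b} * (\<Sum>x\<in>leaf d U v. pmf Dx x)" .
    have "(\<Sum>x\<in>leaf d U v. pmf Dx x * (F x * indicator {w. w ! i = b} x))
        = (\<Sum>x\<in>leaf d U v. F z * (pmf Dx x * indicator {w. w ! i = b} x))"
      by (intro sum.cong refl) (use const in auto)
    also have "\<dots> = (\<Sum>x\<in>leaf d U v. pmf Dx x * F z) * measure_pmf.prob Dx {w. w ! i = b}"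
      by (simp add: * flip: sum_distrib_left sum_distrib_right)
    also have "(\<Sum>x\<in>leaf d U v. pmf Dx x * F z) = (\<Sum>x\<in>leaf d U v. pmf Dx x * F x)"
      by (intro sum.cong refl) (use const in auto)
    finally show ?thesis .
  qed simp
  then show ?thesis
    unfolding sum_leaves[OF U(1)] by (simp add: sum_distrib_right)
qed

text \<open>Fixing coordinate i multiplies the moment and the mass of the leaf by the same
  probability, which cancels in the mean; it is positive because z lies in the support. The
  factorisation is applied to \<open>R \<union> S\<close> because the integrand sees m through
  \<open>R\<close> and the leaf through \<open>S\<close>.\<close>

lemma leaf_mean_irrelevant:
  assumes indep: "independent_features d Dx" and R: "relevant_features d r m R"
    and S: "S \<subseteq> {..<d}" "i < d" "i \<notin> R" "i \<notin> S" and z: "z \<in> set_pmf Dx"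
  shows "leaf_mean (insert i S) (nths z (insert i S)) = leaf_mean S (nths z S)"
proof -
  let ?\<pi> = "measure_pmf.prob Dx {w. w ! i = z ! i}"
  let ?I = "indicator {w. nths w S = nths z S} :: bool list \<Rightarrow> real"
  have zc: "z \<in> cube d" using z support by auto
  have U: "R \<union> S \<subseteq> {..<d}" "i \<notin> R \<union> S" using S R by (auto simp: relevant_features_def)
  have leaf_insert: "leaf d (insert i S) (nths z (insert i S)) = {x \<in> cube d. nths x S = nths z S \<and> x ! i = z ! i}"
    using zc S by (auto simp: leaf_def nths_eq_iff)
  \<comment> \<open>One factorisation serves both quantities: g = m for the moment, g = 1 for the
    mass.\<close>
  have factor: "(\<Sum>x\<in>leaf d (insert i S) (nths z (insert i S)). pmf Dx x * g x)
      = (\<Sum>x\<in>leaf d S (nths z S). pmf Dx x * g x) * ?\<pi>"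
    if g: "\<And>x y. x \<in> cube d \<Longrightarrow> y \<in> cube d \<Longrightarrow> (\<And>i. i \<in> R \<Longrightarrow> x ! i = y ! i) \<Longrightarrow> g x = g y" for g
  proof -
    have "(\<Sum>x\<in>leaf d (insert i S) (nths z (insert i S)). pmf Dx x * g x)
        = (\<Sum>x\<in>cube d. pmf Dx x * ((g x * ?I x) * indicator {w. w ! i = z ! i} x))"
      unfolding leaf_insert by (intro sum.mono_neutral_cong_left) (auto simp: indicator_def)
    also have "\<dots> = (\<Sum>x\<in>cube d. pmf Dx x * (g x * ?I x)) * ?\<pi>"
    proof (rule independent_feature_factor[OF indep U(1) S(2) U(2)])
      fix x y assume xy: "x \<in> cube d" "y \<in> cube d" "nths x (R \<union> S) = nths y (R \<union> S)"
      then have agree: "\<forall>i\<in>R \<union> S. x ! i = y ! i" using U by (simp add: nths_eq_iff)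
      then have "g x = g y" using xy by (intro g) auto
      moreover have "nths x S = nths y S" using agree xy S by (simp add: nths_eq_iff)
      ultimately show "g x * ?I x = g y * ?I y" by (simp add: indicator_def)
    qed
    also have "(\<Sum>x\<in>cube d. pmf Dx x * (g x * ?I x)) = (\<Sum>x\<in>leaf d S (nths z S). pmf Dx x * g x)"
      unfolding leaf_def by (intro sum.mono_neutral_cong_right) (auto simp: indicator_def)
    finally show ?thesis .
  qed
  have "?\<pi> > 0" using z by (auto simp: measure_pmf_posI)
  moreover have "moment d Dx m (insert i S) (nths z (insert i S)) = moment d Dx m S (nths z S) * ?\<pi>"
    unfolding moment_def by (rule factor) (rule relevant_feature_eq[OF R])
  moreover have "mass d Dx (insert i S) (nths z (insert i S)) = mass d Dx S (nths z S) * ?\<pi>"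
    unfolding mass_def using factor[of "\<lambda>_. 1"] by simp
  ultimately show ?thesis by (simp add: leaf_mean_def)
qed

lemma gap_irrelevant:
  assumes "independent_features d Dx" "relevant_features d r m R" "S \<subseteq> {..<d}" "i < d" "i \<notin> R"
  shows "gap (insert i S) = gap S"
proof (cases "i \<in> S")
  case False
  have "Vbar Dx m (insert i S) = Vbar Dx m S"
    unfolding Vbar_conv_sum using assms False
    by (intro sum.cong refl) (metis leaf_mean_irrelevant mult_eq_0_iff set_pmf_iff)
  then show ?thesis by (simp add: gap_def)
qed (simp add: insert_absorb)

text \<open>Adding the relevant features one at a time telescopes from \<open>gap S\<close> to
  \<open>gap (S \<union> R)\<close>, which is 0; submodularity bounds each decrease by C times the
  gain of that feature at \<open>S\<close>. Read backwards with r > 0, some relevant feature gains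
  at least \<open>gap S / (C * r)\<close>.\<close>

lemma gap_le_relevant_gains:
  assumes R: "relevant_features d r m R" and sub: "approx_submodular d C (Vbar Dx m)"
    and "C \<ge> 0" and S: "S \<subseteq> {..<d}" and g: "\<And>i. i \<in> R \<Longrightarrow> gap S - gap (insert i S) \<le> g"
  shows "gap S \<le> C * r * g"
proof -
  have Rd: "R \<subseteq> {..<d}" "card R = r" using R by (auto simp: relevant_features_def)
  have fin: "finite R" using finite_subset[OF Rd(1)] by simp
  have "gap S - gap (S \<union> Q) \<le> C * card Q * g" if "Q \<subseteq> R" for Q
    using finite_subset[OF that fin] that
  proof (induction Q rule: finite_induct)
    case (insert i Q)
    have "Vbar Dx m ((S \<union> Q) \<union> {i}) - Vbar Dx m (S \<union> Q) \<le> C * (Vbar Dx m (S \<union> {i}) - Vbar Dx m S)"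
      using insert.prems S Rd sub[unfolded approx_submodular_def, rule_format, of S "S \<union> Q" i] by auto
    then have "gap (S \<union> Q) - gap (S \<union> insert i Q) \<le> C * (gap S - gap (insert i S))"
      by (simp add: gap_def)
    also have "\<dots> \<le> C * g" using insert.prems g \<open>C \<ge> 0\<close> by (intro mult_left_mono) auto
    finally have "gap S - gap (S \<union> insert i Q) \<le> C * card Q * g + C * g"
      using insert.IH insert.prems by auto
    then show ?case using insert.hyps by (simp add: algebra_simps)
  qed simp
  from this[of R] show ?thesis
    using Rd S by (simp add: gap_relevant[OF R, of "S \<union> R"])
qed

end

section \<open>Partitions produced by the algorithm\<close>

text \<open>Refused splits leave cells coarser than the leaves of \<open>S\<close>, so agreement on
  \<open>S\<close> can be demanded only relative to sample points. The last two clauses together say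
  that the samples in a cell, if there are any, form exactly one sample leaf.\<close>

definition consistent :: "nat \<Rightarrow> nat \<Rightarrow> sample \<Rightarrow> nat set \<Rightarrow> bool list set set \<Rightarrow> bool" where
  "consistent d n D S P \<longleftrightarrow>
     (\<forall>x\<in>cube d. \<exists>!A. A \<in> P \<and> x \<in> A) \<and>
     (\<forall>A\<in>P. \<forall>j<n. \<forall>z\<in>cube d. fst (D j) \<in> A \<longrightarrow> (\<forall>i\<in>S. z ! i = fst (D j) ! i) \<longrightarrow> z \<in> A) \<and>
     (\<forall>A\<in>P. \<forall>j<n. \<forall>k<n. fst (D j) \<in> A \<longrightarrow> fst (D k) \<in> A \<longrightarrow> (\<forall>i\<in>S. fst (D j) ! i = fst (D k) ! i))"
lemma consistentD:
  assumes "consistent d n D S P"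
  shows "x \<in> cube d \<Longrightarrow> \<exists>!A. A \<in> P \<and> x \<in> A"
    and "A \<in> P \<Longrightarrow> j < n \<Longrightarrow> z \<in> cube d \<Longrightarrow> fst (D j) \<in> A \<Longrightarrow> (\<And>i. i \<in> S \<Longrightarrow> z ! i = fst (D j) ! i) \<Longrightarrow> z \<in> A"
    and "A \<in> P \<Longrightarrow> j < n \<Longrightarrow> k < n \<Longrightarrow> fst (D j) \<in> A \<Longrightarrow> fst (D k) \<in> A \<Longrightarrow> i \<in> S \<Longrightarrow> fst (D j) ! i = fst (D k) ! i"
    apply -
  subgoal by (rule assms[unfolded consistent_def, THEN conjunct1, rule_format])
  subgoal by (rule assms[unfolded consistent_def, THEN conjunct2, THEN conjunct1, rule_format])
  subgoal by (rule assms[unfolded consistent_def, THEN conjunct2, THEN conjunct2, rule_format])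
  done

lemma consistent_init: "consistent d n D {} {cube d}"
  by (auto simp: consistent_def)

definition separates :: "nat \<Rightarrow> sample \<Rightarrow> nat \<Rightarrow> bool list set \<Rightarrow> bool" where
  "separates n D i A \<longleftrightarrow> (\<exists>j<n. fst (D j) \<in> A \<and> \<not> fst (D j) ! i) \<and> (\<exists>j<n. fst (D j) \<in> A \<and> fst (D j) ! i)"

lemma split_cell_conv:
  "split_cell n D i A = (if separates n D i A then {{x\<in>A. x ! i = False}, {x\<in>A. x ! i = True}} else {A})"
  by (auto simp: split_cell_def separates_def Let_def)

text \<open>A single implication describes the new cell of x for performed and refused splits
  alike.\<close>

lemma mem_split_cell_iff:
  "B \<in> split_cell n D i A \<and> x \<in> B \<longleftrightarrow> x \<in> A \<and> B = {y\<in>A. separates n D i A \<longrightarrow> y ! i = x ! i}"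
  by (cases "separates n D i A"; cases "x ! i") (auto simp: split_cell_conv)

lemma consistent_split:
  assumes "consistent d n D S P"
  shows "consistent d n D (S \<union> {i}) (\<Union>A\<in>P. split_cell n D i A)"
proof -
  let ?Q = "\<Union>A\<in>P. split_cell n D i A"
  note cons = consistentD[OF assms]
  have mem: "B \<in> ?Q \<and> x \<in> B \<longleftrightarrow>
      (\<exists>A\<in>P. x \<in> A \<and> B = {y\<in>A. separates n D i A \<longrightarrow> y ! i = x ! i})" for B x
    using mem_split_cell_iff[of B n D i _ x] by blast
  show ?thesis
    unfolding consistent_def
  proof (intro conjI ballI allI impI)
    fix x assume "x \<in> cube d"
    then obtain A where A: "A \<in> P" "x \<in> A" and uniq: "\<And>A'. A' \<in> P \<Longrightarrow> x \<in> A' \<Longrightarrow> A' = A"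
      using cons(1) by metis
    show "\<exists>!B. B \<in> ?Q \<and> x \<in> B"
      unfolding mem
    proof (rule ex1I)
      show "\<exists>A'\<in>P. x \<in> A' \<and> {y\<in>A. separates n D i A \<longrightarrow> y ! i = x ! i} = {y\<in>A'. separates n D i A' \<longrightarrow> y ! i = x ! i}"
        using A by (intro bexI[of _ A]) auto
    qed (use uniq in auto)
  next
    fix B j z
    assume B: "B \<in> ?Q" and j: "j < n" "z \<in> cube d"
      and agree: "fst (D j) \<in> B" "\<forall>k\<in>S \<union> {i}. z ! k = fst (D j) ! k"
    obtain A where A: "A \<in> P" "fst (D j) \<in> A" "B = {y\<in>A. separates n D i A \<longrightarrow> y ! i = fst (D j) ! i}"
      using mem[of B "fst (D j)"] B agree by blast
    have "z \<in> A" using agree by (intro cons(2)[OF A(1) j A(2)]) blast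
    then show "z \<in> B" using A(3) agree by blast
  next
    fix B j k l
    assume B: "B \<in> ?Q" and jk: "j < n" "k < n" "fst (D j) \<in> B" "fst (D k) \<in> B" and l: "l \<in> S \<union> {i}"
    obtain A where A: "A \<in> P" "fst (D j) \<in> A" "B = {y\<in>A. separates n D i A \<longrightarrow> y ! i = fst (D j) ! i}"
      using mem[of B "fst (D j)"] B jk by blast
    then have kA: "fst (D k) \<in> A" using jk by blast
    consider "l \<in> S" | "l = i" using l by blast
    then show "fst (D j) ! l = fst (D k) ! l"
    proof cases
      case 1
      then show ?thesis by (rule cons(3)[OF A(1) jk(1,2) A(2) kA])
    next
      case 2
      \<comment> \<open>The reason why refused splits do no harm: the samples in a cell that is not
        split along i share one value of x_i.\<close>
      have "separates n D i A \<or> fst (D j) ! i = fst (D k) ! i"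
        using jk A(2) kA unfolding separates_def by blast
      then show ?thesis using 2 A(3) jk by blast
    qed
  qed
qed

lemma estimator_leaf:
  assumes cons: "consistent d n D S P" and S: "S \<subseteq> {..<d}"
    and D: "\<And>k. k < n \<Longrightarrow> fst (D k) \<in> cube d"
    and x: "x \<in> leaf d S v" and pos: "emp_mass n D S v > 0"
  shows "estimator n D P x = emp_moment n D S v / emp_mass n D S v"
proof -
  have n: "n > 0" using pos by (cases "n = 0") (simp_all add: emp_mass_def)
  have "sample_leaf n D S v \<noteq> {}" using pos by (auto simp: emp_mass_def)
  then obtain j where j: "j < n" "nths (fst (D j)) S = v" by (auto simp: sample_leaf_def)
  have xc: "x \<in> cube d" "nths x S = v" using x by (auto simp: leaf_def)
  note cons = consistentD[OF cons]
  obtain A where A: "A \<in> P" "x \<in> A" and uniq: "\<And>A'. A' \<in> P \<Longrightarrow> x \<in> A' \<Longrightarrow> A' = A"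
    using cons(1)[OF xc(1)] by metis
  have the: "(THE A. A \<in> P \<and> x \<in> A) = A" by (rule the_equality, rule conjI[OF A]) (elim conjE, rule uniq)
  have agree: "nths y S = v \<longleftrightarrow> (\<forall>i\<in>S. y ! i = fst (D j) ! i)" if "y \<in> cube d" for y
    using nths_eq_iff[OF that D[OF j(1)] S] j(2) by simp
  have jA: "fst (D j) \<in> A"
  proof -
    obtain B where B: "B \<in> P" "fst (D j) \<in> B"
      using cons(1)[OF D[OF j(1)]] by metis
    have "x \<in> B" using agree[OF xc(1)] xc(2) by (intro cons(2)[OF B(1) j(1) xc(1) B(2)]) blast
    then show ?thesis using uniq B by blast
  qed
  have "fst (D k) \<in> A \<longleftrightarrow> nths (fst (D k)) S = v" if k: "k < n" for k
    unfolding agree[OF D[OF k]]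
  proof (rule iffI)
    show "\<forall>i\<in>S. fst (D k) ! i = fst (D j) ! i" if "fst (D k) \<in> A"
      by (rule ballI) (rule cons(3)[OF A(1) k j(1) that jA])
    show "fst (D k) \<in> A" if "\<forall>i\<in>S. fst (D k) ! i = fst (D j) ! i"
      by (rule cons(2)[OF A(1) j(1) D[OF k] jA]) (use that in blast)
  qed
  then have "{k \<in> {..<n}. fst (D k) \<in> A} = sample_leaf n D S v" by (auto simp: sample_leaf_def)
  then show ?thesis unfolding estimator_def the by (simp add: average_sample_leaf[OF n])
qed

section \<open>Loop invariants\<close>

lemma finite_best_splits [simp]: "finite (best_splits d n D S)"
  by (simp add: best_splits_def)

lemma best_splits_nonempty:
  assumes "d > 0"
  shows "best_splits d n D S \<noteq> {}"
proof -
  have fin: "finite ((\<lambda>i. Vn n D (S \<union> {i})) ` {..<d})" "(\<lambda>i. Vn n D (S \<union> {i})) ` {..<d} \<noteq> {}"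
    using assms by auto
  from Max_in[OF this] obtain i where i: "i < d" "Max ((\<lambda>i. Vn n D (S \<union> {i})) ` {..<d}) = Vn n D (S \<union> {i})"
    by auto
  then have "i \<in> best_splits d n D S"
    using Max_ge[OF fin(1)] by (auto simp: best_splits_def)
  then show ?thesis by auto
qed

text \<open>Stated on the support of the output distribution, so that its consequences hold for
  every way of breaking ties.\<close>

lemma level_split_loop_invariant:
  assumes "d > 0" "I level S P"
    and "\<And>l S P i. I l S P \<Longrightarrow> real_of_int l < logt \<Longrightarrow> i \<in> best_splits d n D S
           \<Longrightarrow> I (l + 1) (S \<union> {i}) (\<Union>A\<in>P. split_cell n D i A)"
    and "(P', S') \<in> set_pmf (level_split_loop d n logt D level S P)"
  shows "\<exists>l. logt \<le> real_of_int l \<and> I l S' P'"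
  using assms
proof (induction d n logt D level S P rule: level_split_loop.induct)
  case (1 d n logt D level S P)
  show ?case
  proof (cases "real_of_int level < logt")
    case True
    obtain i where i: "i \<in> best_splits d n D S"
      "(P', S') \<in> set_pmf (level_split_loop d n logt D (level + 1) (S \<union> {i}) (\<Union>A\<in>P. split_cell n D i A))"
      using "1.prems"(4) True
      by (subst (asm) level_split_loop.simps)
         (auto simp: set_pmf_of_set[OF best_splits_nonempty[OF "1.prems"(1)]])
    have "i \<in> set_pmf (pmf_of_set (best_splits d n D S))"
      using i(1) by (simp add: set_pmf_of_set[OF best_splits_nonempty[OF "1.prems"(1)]])
    then show ?thesis
      by (rule "1.IH"[OF True _ "1.prems"(1) "1.prems"(3)[OF "1.prems"(2) True i(1)] "1.prems"(3) i(2)])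
  next
    case False
    have "(P', S') = (P, S)"
      using "1.prems"(4) unfolding level_split_loop.simps[of d n logt D level S P] using False by simp
    then show ?thesis using False "1.prems"(2) by (intro exI[of _ level]) auto
  qed
qed

text \<open>\<open>J\<close> is indexed by the number of completed iterations. The size of
  \<open>S\<close> is only bounded by that number, because a feature may be selected again.\<close>

lemma level_split_invariant:
  assumes "d > 0" "logt \<ge> 0" "J 0 {}"
    and step: "\<And>k S i. J k S \<Longrightarrow> S \<subseteq> {..<d} \<Longrightarrow> card S \<le> k \<Longrightarrow> k < nat (\<lceil>logt\<rceil> + 1)
           \<Longrightarrow> i \<in> best_splits d n D S \<Longrightarrow> J (Suc k) (insert i S)"
    and PS: "(P, S) \<in> set_pmf (level_split d n logt D)"
  shows "consistent d n D S P \<and> S \<subseteq> {..<d} \<and> card S \<le> nat (\<lceil>logt\<rceil> + 1) \<and> J (nat (\<lceil>logt\<rceil> + 1)) S"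
proof -
  \<comment> \<open>Level l means l + 1 completed iterations. The clause l < logt + 1, together with
    logt \<le> l on exit, pins the last level to the ceiling of the input, hence one iteration more
    than that.\<close>
  define I where "I = (\<lambda>l S P. -1 \<le> l \<and> (l = -1 \<or> real_of_int l < logt + 1) \<and> consistent d n D S P \<and>
    S \<subseteq> {..<d} \<and> card S \<le> nat (l + 1) \<and> J (nat (l + 1)) S)"
  have "\<exists>l. logt \<le> real_of_int l \<and> I l S P"
  proof (rule level_split_loop_invariant[OF \<open>d > 0\<close> _ _ PS[unfolded level_split_def]])
    show "I (- 1) {} {cube d}" using assms(3) by (simp add: I_def consistent_init)
  next
    fix l S P i assume I: "I l S P" and l: "real_of_int l < logt" and i: "i \<in> best_splits d n D S"
    have suc: "nat (l + 1 + 1) = Suc (nat (l + 1))" using I unfolding I_def by linarith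
    have fin: "finite S" using I finite_subset unfolding I_def by blast
    have "nat (l + 1) < nat (\<lceil>logt\<rceil> + 1)" using l I unfolding I_def by linarith
    then have "J (nat (l + 1 + 1)) (insert i S)" unfolding suc using I i by (intro step) (auto simp: I_def)
    then show "I (l + 1) (S \<union> {i}) (\<Union>A\<in>P. split_cell n D i A)"
      using I l i fin consistent_split[of d n D S P i] suc
      by (auto simp: I_def best_splits_def card_insert_if)
  qed
  then obtain l where l: "logt \<le> real_of_int l" "I l S P" by auto
  have "l = \<lceil>logt\<rceil>" using l \<open>logt \<ge> 0\<close> unfolding I_def by linarith
  then show ?thesis using l by (auto simp: I_def)
qed

section \<open>Concentration over all leaves\<close>

text \<open>The sum is the expansion of (1 + 1/d)^d, which is at most e.\<close>

lemma sum_subset_weights_le: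
  assumes "d > 0"
  shows "(\<Sum>S\<in>Pow {..<d}. (1 / real d) ^ card S) \<le> 3"
proof -
  have "(\<Sum>S\<in>Pow {..<d}. (1 / real d) ^ card S) = (\<Prod>i<d. 1 / real d + 1)"
    using prod_add[of "{..<d}" "\<lambda>_. 1 / real d" "\<lambda>_. 1 :: real"] by simp
  also have "\<dots> = (1 / real d + 1) ^ d" by simp
  also have "\<dots> \<le> exp (1 / real d) ^ d"
    using exp_ge_add_one_self[of "1 / real d"] by (intro power_mono) (auto simp: add.commute)
  also have "\<dots> = exp 1" using assms by (simp flip: exp_of_nat_mult)
  finally show ?thesis using exp_le by simp
qed

text \<open>The base of \<open>polylog\<close> for the lists in use. Since log 2^r = r, it absorbs
  factors such as r + 1 and log n.\<close>

definition size_factor :: "real \<Rightarrow> nat \<Rightarrow> real \<Rightarrow> real" where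
  "size_factor n r z = 1 + (log 2 n + (real r + log 2 z))"

lemma Omega_tilde_conv: "Omega_tilde K p [n, 2 ^ r, z] a = K * a * size_factor n r z ^ p"
  by (simp add: Omega_tilde_def polylog_def size_factor_def log_nat_power)

lemma size_factor_bounds:
  assumes "n \<ge> 1" "z \<ge> 1"
  shows "1 \<le> size_factor n r z" "real r + 1 \<le> size_factor n r z" "log 2 n + 1 \<le> size_factor n r z"
  using assms by (auto simp: size_factor_def)

lemma le_sqrt_self: "0 \<le> x \<Longrightarrow> x \<le> 1 \<Longrightarrow> x \<le> sqrt (x :: real)"
  by (rule real_le_rsqrt) (simp add: power2_eq_square mult_left_le_one_le)

section \<open>Law of a single observation\<close>

locale regression =
  fixes d :: nat and Dx :: "bool list pmf" and E :: "real measure" and m :: "bool list \<Rightarrow> real"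
  assumes model: "regression_model d Dx E m"
begin

sublocale feature_model d Dx m
  using model by unfold_locales (auto simp: regression_model_def abs_le_iff minus_le_iff)

sublocale noise: prob_space E
  using model by (simp add: regression_model_def)

lemma sets_E [measurable_cong, simp]: "sets E = sets borel"
  using model by (simp add: regression_model_def)

lemma noise_bounded: "AE e in E. \<bar>e\<bar> \<le> 1 / 2"
proof -
  have "AE e in E. e \<in> {-1/2..1/2}" using model by (simp add: regression_model_def)
  then show ?thesis by eventually_elim auto
qed

lemma noise_mean: "(\<integral>e. e \<partial>E) = 0"
  using model by (simp add: regression_model_def)

sublocale joint: pair_prob_space "measure_pmf Dx" E ..

lemma observe_measurable [measurable]:
  "(\<lambda>(x, e). (x, m x + e)) \<in> measure_pmf Dx \<Otimes>\<^sub>M E \<rightarrow>\<^sub>M count_space UNIV \<Otimes>\<^sub>M borel"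
proof -
  have [measurable]: "m \<in> borel_measurable (measure_pmf Dx)" by simp
  show ?thesis by measurable
qed

lemma sets_observation_law [measurable_cong]:
  "sets (observation_law Dx E m) = sets (count_space UNIV \<Otimes>\<^sub>M borel)"
  by (simp add: observation_law_def)

lemma prob_space_observation_law: "prob_space (observation_law Dx E m)"
  unfolding observation_law_def by (rule joint.prob_space_distr) (rule observe_measurable)

lemma AE_joint: "AE z in measure_pmf Dx \<Otimes>\<^sub>M E. fst z \<in> cube d \<and> \<bar>m (fst z) + snd z\<bar> \<le> 1"
proof -
  have [measurable]: "m \<in> borel_measurable (measure_pmf Dx)" by simp
  have [measurable]: "Measurable.pred (count_space UNIV) (\<lambda>x. x \<in> cube d)" by simp
  show ?thesis
  proof (rule joint.AE_pair_measure)
    show "{z \<in> space (measure_pmf Dx \<Otimes>\<^sub>M E). fst z \<in> cube d \<and> \<bar>m (fst z) + snd z\<bar> \<le> 1}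
        \<in> sets (measure_pmf Dx \<Otimes>\<^sub>M E)" by measurable
    show "AE x in measure_pmf Dx. AE y in E. fst (x, y) \<in> cube d \<and> \<bar>m (fst (x, y)) + snd (x, y)\<bar> \<le> 1"
    proof (intro AE_pmfI)
      fix x assume "x \<in> set_pmf Dx"
      then have x: "x \<in> cube d" using support by auto
      show "AE y in E. fst (x, y) \<in> cube d \<and> \<bar>m (fst (x, y)) + snd (x, y)\<bar> \<le> 1"
        using noise_bounded
      proof eventually_elim
        case (elim y)
        then have "\<bar>m x + y\<bar> \<le> 1" using m_bounded[OF x] by linarith
        then show ?case using x by simp
      qed
    qed
  qed
qed

lemma AE_observation: "AE z in observation_law Dx E m. fst z \<in> cube d \<and> \<bar>snd z\<bar> \<le> 1"
proof -
  have [measurable]: "Measurable.pred (count_space UNIV) (\<lambda>x. x \<in> cube d)" by simp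
  have "{z \<in> space (count_space UNIV \<Otimes>\<^sub>M borel). fst z \<in> cube d \<and> \<bar>snd z :: real\<bar> \<le> 1}
      \<in> sets (count_space UNIV \<Otimes>\<^sub>M borel)" by measurable
  then show ?thesis
    unfolding observation_law_def using AE_joint
    by (subst AE_distr_iff[OF observe_measurable]) (auto simp: case_prod_beta)
qed

definition in_leaf :: "nat set \<Rightarrow> bool list \<Rightarrow> bool list \<times> real \<Rightarrow> real" where
  "in_leaf S v z = indicator {w. nths w S = v} (fst z)"

lemma in_leaf_measurable0: "in_leaf S v \<in> borel_measurable (count_space UNIV \<Otimes>\<^sub>M borel)"
  unfolding in_leaf_def[abs_def] by (rule measurable_compose[OF measurable_fst]) simp

lemma in_leaf_measurable [measurable]: "in_leaf S v \<in> borel_measurable (observation_law Dx E m)"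
  using in_leaf_measurable0 by (simp add: measurable_cong_sets[OF sets_observation_law refl])

lemma snd_measurable [measurable]: "snd \<in> borel_measurable (observation_law Dx E m)"
  using measurable_snd by (simp add: measurable_cong_sets[OF sets_observation_law refl])

lemma in_leaf_square [simp]: "(in_leaf S v z)\<^sup>2 = in_leaf S v z"
  by (simp add: in_leaf_def indicator_def)

lemma integral_product:
  assumes "integrable (measure_pmf Dx \<Otimes>\<^sub>M E) f"
  shows "(\<integral>z. f z \<partial>(measure_pmf Dx \<Otimes>\<^sub>M E)) = (\<Sum>x\<in>cube d. pmf Dx x * (\<integral>e. f (x, e) \<partial>E) :: real)"
  by (simp add: joint.integral_fst'[OF assms, symmetric] expectation_conv_sum)

lemma integral_in_leaf: "(\<integral>z. in_leaf S v z \<partial>observation_law Dx E m) = mass d Dx S v"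
proof -
  define \<phi> :: "bool list \<Rightarrow> real" where "\<phi> = indicator {w. nths w S = v}"
  have [measurable]: "\<phi> \<in> borel_measurable (measure_pmf Dx)" by simp
  have \<phi>: "\<bar>\<phi> x\<bar> \<le> 1" for x by (simp add: \<phi>_def indicator_def)
  have "(\<integral>z. in_leaf S v z \<partial>observation_law Dx E m) = (\<integral>z. \<phi> (fst z) \<partial>(measure_pmf Dx \<Otimes>\<^sub>M E))"
    unfolding observation_law_def
    by (subst integral_distr[OF observe_measurable in_leaf_measurable0])
       (simp add: in_leaf_def case_prod_beta \<phi>_def)
  also have "\<dots> = (\<Sum>x\<in>cube d. pmf Dx x * (\<integral>e. \<phi> (fst (x, e)) \<partial>E))"
    by (rule integral_product, rule joint.integrable_const_bound[where B = 1]) (simp_all add: \<phi>)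
  also have "\<dots> = (\<Sum>x\<in>cube d. pmf Dx x * \<phi> x)"
    by (simp add: noise.prob_space)
  also have "\<dots> = mass d Dx S v"
    unfolding mass_def leaf_def \<phi>_def by (rule sum.mono_neutral_cong_right) auto
  finally show ?thesis .
qed

text \<open>For each fixed x the noise integrates to zero, so on a leaf y has the same moment as
  m.\<close>

lemma integral_in_leaf_snd:
  "(\<integral>z. in_leaf S v z * snd z \<partial>observation_law Dx E m) = moment d Dx m S v"
proof -
  define \<phi> :: "bool list \<Rightarrow> real" where "\<phi> = indicator {w. nths w S = v}"
  have [measurable]: "\<phi> \<in> borel_measurable (measure_pmf Dx)" "m \<in> borel_measurable (measure_pmf Dx)"
    by simp_all
  have \<phi>: "\<bar>\<phi> x\<bar> \<le> 1" for x by (simp add: \<phi>_def indicator_def)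
  have intE: "integrable E (\<lambda>e. e)"
    by (rule noise.integrable_const_bound[where B = "1 / 2"]) (use noise_bounded in auto)
  have bdd: "AE z in measure_pmf Dx \<Otimes>\<^sub>M E. norm (\<phi> (fst z) * (m (fst z) + snd z)) \<le> 1"
    using AE_joint by eventually_elim (use \<phi> in \<open>auto simp: abs_mult mult_le_one\<close>)
  have "(\<integral>z. in_leaf S v z * snd z \<partial>observation_law Dx E m)
      = (\<integral>z. \<phi> (fst z) * (m (fst z) + snd z) \<partial>(measure_pmf Dx \<Otimes>\<^sub>M E))"
    unfolding observation_law_def
    by (subst integral_distr[OF observe_measurable borel_measurable_times[OF in_leaf_measurable0 measurable_snd]])
       (simp add: in_leaf_def case_prod_beta \<phi>_def)
  also have "\<dots> = (\<Sum>x\<in>cube d. pmf Dx x * (\<integral>e. \<phi> (fst (x, e)) * (m (fst (x, e)) + snd (x, e)) \<partial>E))"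
    by (rule integral_product, rule joint.integrable_const_bound[where B = 1, OF bdd]) measurable
  also have "\<dots> = (\<Sum>x\<in>cube d. pmf Dx x * (\<phi> x * m x))"
    using intE by (simp add: noise_mean noise.prob_space)
  also have "\<dots> = moment d Dx m S v"
    unfolding moment_def leaf_def \<phi>_def by (rule sum.mono_neutral_cong_right) auto
  finally show ?thesis .
qed

definition good_sample :: "nat \<Rightarrow> nat \<Rightarrow> real \<Rightarrow> sample \<Rightarrow> bool" where
  "good_sample n s \<eta> D \<longleftrightarrow>
     (\<forall>k<n. fst (D k) \<in> cube d \<and> \<bar>snd (D k)\<bar> \<le> 1) \<and>
     (\<forall>S. S \<subseteq> {..<d} \<and> card S \<le> s \<longrightarrow> (\<forall>v\<in>patterns S.
        \<bar>emp_mass n D S v - mass d Dx S v\<bar> \<le> deviation \<eta> (mass d Dx S v) \<and>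
        \<bar>emp_moment n D S v - moment d Dx m S v\<bar> \<le> deviation \<eta> (mass d Dx S v)))"

lemma emp_mass_conv_in_leaf: "emp_mass n D S v = (\<Sum>k<n. in_leaf S v (D k)) / n"
proof -
  have "(\<Sum>k<n. in_leaf S v (D k)) = (\<Sum>k\<in>sample_leaf n D S v. 1)"
    by (rule sum.mono_neutral_cong_right) (auto simp: in_leaf_def sample_leaf_def indicator_def)
  then show ?thesis by (simp add: emp_mass_def)
qed

lemma emp_moment_conv_in_leaf: "emp_moment n D S v = (\<Sum>k<n. in_leaf S v (D k) * snd (D k)) / n"
proof -
  have "(\<Sum>k<n. in_leaf S v (D k) * snd (D k)) = (\<Sum>k\<in>sample_leaf n D S v. snd (D k))"
    by (rule sum.mono_neutral_cong_right) (auto simp: in_leaf_def sample_leaf_def indicator_def)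
  then show ?thesis by (simp add: emp_moment_def)
qed

text \<open>The constant 12 is 4 * 3: two quantities with two tails each, and the bound 3 on the sum
  of the subset weights. In s ln (2 d) the 2 pays for the leaves of a set and the d for the choice
  of the set. The bounds on x and y hold only almost surely and are therefore kept apart from the
  measurable bad event \<open>B\<close>.\<close>

lemma good_sample_prob:
  assumes d: "d > 0" and n: "n > 0" and \<eta>: "\<eta> > 0" and \<delta>: "0 < \<delta>"
    and large: "ln (12 / \<delta>) + s * ln (2 * d) \<le> n * \<eta>"
  shows "\<exists>B \<in> sets (sample_law n Dx E m). measure (sample_law n Dx E m) B \<le> \<delta> \<and>
           (AE D in sample_law n Dx E m. D \<notin> B \<longrightarrow> good_sample n s \<eta> D)"
proof -
  let ?M = "observation_law Dx E m"
  let ?P = "sample_law n Dx E m"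
  have P: "?P = PiM {..<n} (\<lambda>_. ?M)" by (simp add: sample_law_def)
  interpret P: prob_space ?P
    unfolding P by (intro prob_space_PiM prob_space_observation_law)
  define B1 where "B1 S v = {D \<in> space ?P. \<bar>(\<Sum>k<n. in_leaf S v (D k)) / n
      - (\<integral>z. in_leaf S v z \<partial>?M)\<bar> \<ge> deviation \<eta> (mass d Dx S v)}" for S v
  define B2 where "B2 S v = {D \<in> space ?P. \<bar>(\<Sum>k<n. in_leaf S v (D k) * snd (D k)) / n
      - (\<integral>z. in_leaf S v z * snd z \<partial>?M)\<bar> \<ge> deviation \<eta> (mass d Dx S v)}" for S v
  have [measurable]: "B1 S v \<in> sets ?P" "B2 S v \<in> sets ?P" for S v
    unfolding B1_def B2_def P by measurable
  have B1: "measure ?P (B1 S v) \<le> 2 * exp (- (n * \<eta>))" for S v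
    unfolding B1_def P
  proof (rule bernstein[OF prob_space_observation_law in_leaf_measurable])
    show "AE z in ?M. \<bar>in_leaf S v z\<bar> \<le> 1" by (simp add: in_leaf_def indicator_def)
    show "(\<integral>z. (in_leaf S v z)\<^sup>2 \<partial>?M) \<le> mass d Dx S v" by (simp add: integral_in_leaf)
  qed (use n \<eta> mass_nonneg in auto)
  have bdd: "AE z in ?M. \<bar>in_leaf S v z * snd z\<bar> \<le> 1" for S v
    using AE_observation by eventually_elim (auto simp: in_leaf_def indicator_def)
  have int: "integrable ?M (in_leaf S v)" for S v
    by (rule finite_measure.integrable_const_bound[where B = 1])
       (auto simp: in_leaf_def indicator_def intro: prob_space.finite_measure prob_space_observation_law)
  have B2: "measure ?P (B2 S v) \<le> 2 * exp (- (n * \<eta>))" for S v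
    unfolding B2_def P
  proof (rule bernstein[OF prob_space_observation_law borel_measurable_times[OF in_leaf_measurable snd_measurable]])
    have "(\<integral>z. (in_leaf S v z * snd z)\<^sup>2 \<partial>?M) \<le> (\<integral>z. in_leaf S v z \<partial>?M)"
    proof (rule integral_mono_AE[OF _ int])
      show le: "AE z in ?M. (in_leaf S v z * snd z)\<^sup>2 \<le> in_leaf S v z"
        using AE_observation
        by eventually_elim (auto simp: in_leaf_def indicator_def abs_square_le_1)
      show "integrable ?M (\<lambda>z. (in_leaf S v z * snd z)\<^sup>2)"
      proof (rule Bochner_Integration.integrable_bound[OF int[of S v]])
        show "AE z in ?M. norm ((in_leaf S v z * snd z)\<^sup>2) \<le> norm (in_leaf S v z)"
          using le by eventually_elim (auto intro: order_trans)
      qed measurable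
    qed
    then show "(\<integral>z. (in_leaf S v z * snd z)\<^sup>2 \<partial>?M) \<le> mass d Dx S v" by (simp add: integral_in_leaf)
  qed (use n \<eta> mass_nonneg bdd in auto)
  define I where "I = {S \<in> Pow {..<d}. card S \<le> s}"
  define B where "B = (\<Union>S\<in>I. \<Union>v\<in>patterns S. B1 S v \<union> B2 S v)"
  have finI: "finite I" by (simp add: I_def)
  have meas: "B \<in> sets ?P" unfolding B_def using finI by (intro sets.finite_UN sets.Un) auto
  \<comment> \<open>The weights $(2d)^{-|S|}$ make the union bound over all leaves of all \<open>S\<close> summable.\<close>
  have weight: "4 * exp (- (n * \<eta>)) * 2 ^ card S \<le> \<delta> / 3 * (1 / real d) ^ card S" if "S \<in> I" for S
  proof -
    have "0 \<le> ln (2 * real d)" using d by simp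
    then have "real (card S) * ln (2 * d) \<le> s * ln (2 * d)"
      using that by (intro mult_right_mono) (auto simp: I_def)
    then have "exp (- (n * \<eta>)) \<le> exp (- (ln (12 / \<delta>) + card S * ln (2 * d)))"
      using large by simp
    moreover have "exp (ln (12 / \<delta>) + card S * ln (2 * d)) = 12 / \<delta> * (2 * d) ^ card S"
      using d \<delta> by (simp add: exp_add exp_of_nat_mult)
    ultimately have "exp (- (n * \<eta>)) \<le> 1 / (12 / \<delta> * (2 * d) ^ card S)"
      unfolding exp_minus by (simp only: inverse_eq_divide)
    then show ?thesis using d \<delta> by (simp add: field_simps power_mult_distrib)
  qed
  have "measure ?P B \<le> (\<Sum>S\<in>I. measure ?P (\<Union>v\<in>patterns S. B1 S v \<union> B2 S v))"
    unfolding B_def using finI by (intro measure_UNION_le) (auto intro!: sets.finite_UN)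
  also have "\<dots> \<le> (\<Sum>S\<in>I. 4 * exp (- (n * \<eta>)) * 2 ^ card S)"
  proof (rule sum_mono)
    fix S
    have "measure ?P (\<Union>v\<in>patterns S. B1 S v \<union> B2 S v) \<le> (\<Sum>v\<in>patterns S. measure ?P (B1 S v \<union> B2 S v))"
      by (intro measure_UNION_le) auto
    also have "\<dots> \<le> (\<Sum>v\<in>patterns S. 4 * exp (- (n * \<eta>)))"
    proof (rule sum_mono)
      fix v
      have "measure ?P (B1 S v \<union> B2 S v) \<le> measure ?P (B1 S v) + measure ?P (B2 S v)"
        by (rule measure_Un_le) auto
      then show "measure ?P (B1 S v \<union> B2 S v) \<le> 4 * exp (- (n * \<eta>))"
        using B1[of S v] B2[of S v] by simp
    qed
    finally show "measure ?P (\<Union>v\<in>patterns S. B1 S v \<union> B2 S v) \<le> 4 * exp (- (n * \<eta>)) * 2 ^ card S"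
      by (simp add: card_patterns mult.commute)
  qed
  also have "\<dots> \<le> (\<Sum>S\<in>I. \<delta> / 3 * (1 / real d) ^ card S)" by (intro sum_mono weight)
  also have "\<dots> \<le> (\<Sum>S\<in>Pow {..<d}. \<delta> / 3 * (1 / real d) ^ card S)"
    using \<delta> by (intro sum_mono2) (auto simp: I_def)
  also have "\<dots> = \<delta> / 3 * (\<Sum>S\<in>Pow {..<d}. (1 / real d) ^ card S)"
    by (simp add: sum_distrib_left)
  also have "\<dots> \<le> \<delta> / 3 * 3"
    using \<delta> by (intro mult_left_mono sum_subset_weights_le d) auto
  finally have prob: "measure ?P B \<le> \<delta>" by simp
  have "AE D in ?P. \<forall>k\<in>{..<n}. fst (D k) \<in> cube d \<and> \<bar>snd (D k)\<bar> \<le> 1"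
    unfolding P
    by (intro eventually_ball_finite ballI AE_PiM_component[where P = "\<lambda>z. fst z \<in> cube d \<and> \<bar>snd z\<bar> \<le> 1"]
          prob_space_observation_law AE_observation) auto
  then have "AE D in ?P. D \<notin> B \<longrightarrow> good_sample n s \<eta> D"
    using AE_space
  proof eventually_elim
    case (elim D)
    show ?case
    proof
      assume "D \<notin> B"
      then have "D \<notin> B1 S v" "D \<notin> B2 S v" if "S \<subseteq> {..<d}" "card S \<le> s" "v \<in> patterns S" for S v
        using that by (auto simp: B_def I_def)
      then show "good_sample n s \<eta> D"
        using elim
        unfolding good_sample_def B1_def B2_def integral_in_leaf integral_in_leaf_snd
          emp_mass_conv_in_leaf[symmetric] emp_moment_conv_in_leaf[symmetric]
        by (auto simp: not_le intro: less_imp_le)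
    qed
  qed
  then show ?thesis using meas prob by blast
qed

text \<open>
  Measurability of the algorithm in the sample is not needed: if the integrand is not integrable, then
  its Bochner integral is 0 by convention.
\<close>

lemma prob_mse_exceeds_le:
  assumes B: "B \<in> sets (sample_law n Dx E m)" "measure (sample_law n Dx E m) B \<le> \<delta>"
    and good: "AE D in sample_law n Dx E m. D \<notin> B \<longrightarrow>
      (\<forall>(P, S)\<in>set_pmf (level_split d n logt D). mse Dx m (estimator n D P) \<le> \<tau>)"
  shows "prob_mse_exceeds d n logt Dx E m \<tau> \<le> \<delta>"
proof -
  let ?P = "sample_law n Dx E m"
  let ?f = "\<lambda>D. measure_pmf.prob (level_split d n logt D) {(P, S). mse Dx m (estimator n D P) > \<tau>}"
  interpret P: prob_space ?P
    unfolding sample_law_def by (intro prob_space_PiM prob_space_observation_law)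
  show ?thesis
  proof (cases "integrable ?P ?f")
    case True
    have "(\<integral>D. ?f D \<partial>?P) \<le> (\<integral>D. indicator B D \<partial>?P)"
    proof (rule integral_mono_AE[OF True])
      show "integrable ?P (indicator B :: _ \<Rightarrow> real)" using B by (simp add: P.emeasure_eq_measure)
      show "AE D in ?P. ?f D \<le> indicator B D"
        using good
      proof eventually_elim
        case (elim D)
        show ?case
        proof (cases "D \<in> B")
          case False
          then have "set_pmf (level_split d n logt D) \<inter> {(P, S). mse Dx m (estimator n D P) > \<tau>} = {}"
            using elim by fastforce
          then have "?f D = 0" by (subst measure_pmf_zero_iff)
          then show ?thesis by simp
        qed simp
      qed
    qed
    also have "\<dots> = measure ?P B" using B by simp
    finally show ?thesis using B by (simp add: prob_mse_exceeds_def)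
  next
    case False
    then have "prob_mse_exceeds d n logt Dx E m \<tau> = 0"
      by (simp add: prob_mse_exceeds_def not_integrable_integral_eq)
    then show ?thesis using B measure_nonneg[of ?P B] by linarith
  qed
qed

section \<open>Greedy selection on a good sample\<close>

text \<open>On a good sample V_n is within 9 \<open>err\<close> of Vbar for all sets of size at most
  s, so comparing two candidate splits costs 18 \<open>err\<close>.\<close>

definition err :: "nat \<Rightarrow> real \<Rightarrow> real" where
  "err s \<eta> = sqrt (2 ^ s * \<eta>)"

lemma abs_estimator_le_1:
  assumes "good_sample n s \<eta> D"
  shows "\<bar>estimator n D P x\<bar> \<le> 1"
  unfolding estimator_def
  by (rule abs_average_le_1) (use assms in \<open>auto simp: good_sample_def\<close>)

text \<open>Settles the cases in which the claimed threshold is at least a suitable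
  constant.\<close>

lemma mse_estimator_le:
  assumes "good_sample n s \<eta> D"
  shows "mse Dx m (estimator n D P) \<le> 9 / 4"
proof -
  have "mse Dx m (estimator n D P) \<le> (\<Sum>x\<in>cube d. pmf Dx x * (9 / 4))"
    unfolding mse_def expectation_conv_sum
  proof (intro sum_mono mult_left_mono)
    fix x assume "x \<in> cube d"
    then have "\<bar>m x - estimator n D P x\<bar> \<le> 3 / 2"
      using m_bounded[of x] abs_estimator_le_1[OF assms, of P x] by linarith
    then have "\<bar>m x - estimator n D P x\<bar>\<^sup>2 \<le> (3 / 2)\<^sup>2" by (intro power_mono) auto
    then show "(m x - estimator n D P x)\<^sup>2 \<le> 9 / 4" by (simp add: power2_eq_square)
  qed simp
  also have "\<dots> = 9 / 4"
    using sum_pmf_eq_1[OF finite_cube support] by (subst sum_distrib_right[symmetric]) simp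
  finally show ?thesis .
qed

lemma mse_estimator_le_gap:
  assumes good: "good_sample n s \<eta> D" and "n > 0" "\<eta> > 0"
    and S: "consistent d n D S P" "S \<subseteq> {..<d}" "card S \<le> s"
  shows "mse Dx m (estimator n D P) \<le> gap S + 72 * (2 ^ s * \<eta>)"
proof -
  have "mse Dx m (estimator n D P) \<le> gap S + 72 * 2 ^ card S * \<eta>"
  proof (rule error_le_gap)
    show "estimator n D P x = emp_moment n D S v / emp_mass n D S v"
      if "x \<in> leaf d S v" "emp_mass n D S v > 0" for v x
      using good that by (intro estimator_leaf[OF S(1,2)]) (auto simp: good_sample_def)
    show "\<bar>estimator n D P x\<bar> \<le> 1" for x by (rule abs_estimator_le_1[OF good])
  qed (use assms in \<open>auto simp: good_sample_def\<close>)
  also have "72 * 2 ^ card S * \<eta> \<le> 72 * 2 ^ s * \<eta>"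
    using assms by (intro mult_left_mono mult_right_mono power_increasing) auto
  finally show ?thesis by simp
qed

lemma best_split_gap:
  assumes good: "good_sample n s \<eta> D" and n: "n > 0" "\<eta> > 0" "2 ^ s * \<eta> \<le> 1"
    and S: "S \<subseteq> {..<d}" "card S < s" and i: "i \<in> best_splits d n D S" and j: "j < d"
  shows "gap (insert i S) \<le> gap (insert j S) + 18 * err s \<eta>"
proof -
  have close: "\<bar>Vn n D (insert k S) - Vbar Dx m (insert k S)\<bar> \<le> 9 * err s \<eta>" if "k < d" for k
  proof -
    have sub: "insert k S \<subseteq> {..<d}" using S that by auto
    have card: "card (insert k S) \<le> s"
      using S finite_subset[OF S(1)] by (simp add: card_insert_if)
    show ?thesis
      unfolding err_def
    proof (rule Vn_close[OF sub n(1,2) _ n(3)])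
      show "2 ^ card (insert k S) * \<eta> \<le> 2 ^ s * \<eta>"
        using card n by (intro mult_right_mono power_increasing) auto
    qed (use good sub card in \<open>auto simp: good_sample_def\<close>)
  qed
  have "i < d" "Vn n D (insert j S) \<le> Vn n D (insert i S)"
    using i j by (auto simp: best_splits_def)
  then show ?thesis
    using close[OF \<open>i < d\<close>] close[OF j] unfolding gap_def by linarith
qed

text \<open>With a = C r, a step turns a gap g into at most (1 - 1/a) g + 18 \<open>err\<close>. The
  additive term 18 a \<open>err\<close> is the fixed point of this recursion and hence does not grow
  with the number of steps; 1/4 bounds the initial gap.\<close>

lemma gap_greedy:
  assumes good: "good_sample n s \<eta> D" and n: "n > 0" "\<eta> > 0" "2 ^ s * \<eta> \<le> 1"
    and R: "relevant_features d r m R" and sub: "approx_submodular d C (Vbar Dx m)" and "C \<ge> 1" "r \<ge> 1"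
    and "d > 0" "logt \<ge> 0" and s: "s = nat (\<lceil>logt\<rceil> + 1)"
    and PS: "(P, S) \<in> set_pmf (level_split d n logt D)"
  shows "consistent d n D S P \<and> S \<subseteq> {..<d} \<and> card S \<le> s \<and>
         gap S \<le> (1 - 1 / (C * r)) ^ s / 4 + 18 * (C * r) * err s \<eta>"
  unfolding s
proof (rule level_split_invariant[OF \<open>d > 0\<close> \<open>logt \<ge> 0\<close> _ _ PS,
      where J = "\<lambda>k S. gap S \<le> (1 - 1 / (C * r)) ^ k / 4 + 18 * (C * r) * err (nat (\<lceil>logt\<rceil> + 1)) \<eta>"])
  have Cr: "1 \<le> C * r" using assms mult_mono[of 1 C 1 "real r"] by simp
  have err: "0 \<le> err s \<eta>" using n by (simp add: err_def)
  show "gap {} \<le> (1 - 1 / (C * r)) ^ 0 / 4 + 18 * (C * r) * err (nat (\<lceil>logt\<rceil> + 1)) \<eta>"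
    using gap_le_quarter[of "{}"] Cr err s by (simp add: add_increasing2)
  fix k S i
  assume IH: "gap S \<le> (1 - 1 / (C * r)) ^ k / 4 + 18 * (C * r) * err (nat (\<lceil>logt\<rceil> + 1)) \<eta>"
    and S: "S \<subseteq> {..<d}" "card S \<le> k" "k < nat (\<lceil>logt\<rceil> + 1)" and i: "i \<in> best_splits d n D S"
  \<comment> \<open>No relevant gain exceeds the decrease actually achieved by more than the
    comparison error.\<close>
  let ?g = "gap S - gap (insert i S) + 18 * err s \<eta>"
  have "gap S \<le> C * r * ?g"
  proof (rule gap_le_relevant_gains[OF R sub _ S(1)])
    show "gap S - gap (insert j S) \<le> ?g" if "j \<in> R" for j
      using that R S s best_split_gap[OF good n S(1) _ i, of j] by (auto simp: relevant_features_def)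
  qed (use \<open>C \<ge> 1\<close> in simp)
  then have "gap S / (C * r) \<le> ?g" using Cr by (simp add: pos_divide_le_eq mult.commute)
  then have "gap (insert i S) \<le> (1 - 1 / (C * r)) * gap S + 18 * err s \<eta>"
    by (simp add: algebra_simps)
  also have "(1 - 1 / (C * r)) * gap S
      \<le> (1 - 1 / (C * r)) * ((1 - 1 / (C * r)) ^ k / 4 + 18 * (C * r) * err s \<eta>)"
    using IH Cr s by (intro mult_left_mono) auto
  also have "\<dots> + 18 * err s \<eta> = (1 - 1 / (C * r)) ^ Suc k / 4 + 18 * (C * r) * err s \<eta>"
  proof -
    define a where "a = C * r"
    have "a > 0" using Cr unfolding a_def by linarith
    then show ?thesis unfolding a_def[symmetric] by (simp add: field_simps)
  qed
  finally show "gap (insert i S) \<le> (1 - 1 / (C * r)) ^ Suc k / 4 + 18 * (C * r) * err (nat (\<lceil>logt\<rceil> + 1)) \<eta>"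
    by (simp add: s)
qed

text \<open>The run collects new relevant features until it picks an irrelevant or repeated one.
  That pick does not change the gap, so its near-optimality bounds all relevant gains by 18
  \<open>err\<close> and submodularity bounds the gap; later steps cannot increase it.\<close>

lemma gap_greedy_independent:
  assumes good: "good_sample n (r + 1) \<eta> D" and n: "n > 0" "\<eta> > 0" "2 ^ (r + 1) * \<eta> \<le> 1"
    and R: "relevant_features d r m R" and sub: "approx_submodular d C (Vbar Dx m)" and "C \<ge> 1"
    and indep: "independent_features d Dx" and "d > 0"
    and PS: "(P, S) \<in> set_pmf (level_split d n (real r) D)"
  shows "consistent d n D S P \<and> S \<subseteq> {..<d} \<and> card S \<le> r + 1 \<and>
         gap S \<le> C * r * (18 * err (r + 1) \<eta>)"
proof -
  let ?b = "C * r * (18 * err (r + 1) \<eta>)"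
  have s: "nat (\<lceil>real r\<rceil> + 1) = r + 1" by simp
  have Rd: "R \<subseteq> {..<d}" "card R = r" using R by (auto simp: relevant_features_def)
  have fin: "finite R" using finite_subset[OF Rd(1)] by simp
  have "consistent d n D S P \<and> S \<subseteq> {..<d} \<and> card S \<le> nat (\<lceil>real r\<rceil> + 1) \<and>
    (gap S \<le> ?b \<or> S \<subseteq> R \<and> card S = nat (\<lceil>real r\<rceil> + 1))"
  proof (rule level_split_invariant[OF \<open>d > 0\<close> _ _ _ PS, where J = "\<lambda>k S. gap S \<le> ?b \<or> S \<subseteq> R \<and> card S = k"])
    fix k S i
    assume IH: "gap S \<le> ?b \<or> S \<subseteq> R \<and> card S = k"
      and S: "S \<subseteq> {..<d}" "card S \<le> k" "k < nat (\<lceil>real r\<rceil> + 1)" and i: "i \<in> best_splits d n D S"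
    have id: "i < d" using i by (simp add: best_splits_def)
    consider "gap S \<le> ?b" | "S \<subseteq> R" "card S = k" "i \<in> R - S" | "i \<notin> R \<or> i \<in> S" "\<not> gap S \<le> ?b"
      using IH by blast
    then show "gap (insert i S) \<le> ?b \<or> insert i S \<subseteq> R \<and> card (insert i S) = Suc k"
    proof cases
      case 1
      then show ?thesis using gap_antimono[OF subset_insertI[of S i]] S id by auto
    next
      case 2
      then show ?thesis using finite_subset[OF _ fin, of S] by auto
    next
      case 3
      then have same: "gap (insert i S) = gap S"
        using gap_irrelevant[OF indep R S(1) id] by (auto simp: insert_absorb)
      have "gap S \<le> ?b"
      proof (rule gap_le_relevant_gains[OF R sub _ S(1)])
        show "gap S - gap (insert j S) \<le> 18 * err (r + 1) \<eta>" if "j \<in> R" for j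
          using that Rd S s same best_split_gap[OF good n S(1) _ i, of j] by auto
      qed (use \<open>C \<ge> 1\<close> in simp)
      then show ?thesis using same by simp
    qed
  qed auto
  \<comment> \<open>The input r gives r + 1 iterations, one more than there are relevant
    features.\<close>
  moreover have "\<not> (S \<subseteq> R \<and> card S = r + 1)"
    using card_mono[OF fin, of S] Rd by auto
  ultimately show ?thesis unfolding s by blast
qed

text \<open>While a relevant feature l is missing, an irrelevant or repeated pick leaves a gap
  larger by at least \<beta> than picking l would, which exceeds the comparison error.\<close>

lemma gap_greedy_strongly_sparse:
  assumes good: "good_sample n (r + 1) \<eta> D" and n: "n > 0" "\<eta> > 0" "2 ^ (r + 1) * \<eta> \<le> 1"
    and sparse: "strongly_sparse d \<beta> r Dx m" and \<beta>: "18 * err (r + 1) \<eta> < \<beta>" and "r < d"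
    and PS: "(P, S) \<in> set_pmf (level_split d n (real r) D)"
  shows "consistent d n D S P \<and> S \<subseteq> {..<d} \<and> card S \<le> r + 1 \<and> gap S = 0"
proof -
  have s: "nat (\<lceil>real r\<rceil> + 1) = r + 1" by simp
  have "d > 0" using \<open>r < d\<close> by simp
  obtain R where R: "relevant_features d r m R"
    and strong: "\<And>i j T. i \<in> R \<Longrightarrow> j < d \<Longrightarrow> j \<notin> R \<Longrightarrow> T \<subset> {..<d} - {i} \<Longrightarrow>
          gap (insert i T) + \<beta> \<le> gap (insert j T)"
  proof -
    from sparse obtain R where R: "relevant_features d r m R" and
      strong: "\<forall>i\<in>R. \<forall>j\<in>{..<d} - R. \<forall>T. T \<subset> {..<d} - {i} \<longrightarrow>
        Vbar Dx m (T \<union> {j}) - Vbar Dx m T + \<beta> \<le> Vbar Dx m (T \<union> {i}) - Vbar Dx m T"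
      unfolding strongly_sparse_def by (elim exE conjE)
    have "gap (insert i T) + \<beta> \<le> gap (insert j T)"
      if "i \<in> R" "j < d" "j \<notin> R" "T \<subset> {..<d} - {i}" for i j T
      using strong[rule_format, of i j T] that by (simp add: gap_def)
    with R show thesis by (rule that)
  qed
  have Rd: "R \<subseteq> {..<d}" "card R = r" using R by (auto simp: relevant_features_def)
  have fin: "finite R" using finite_subset[OF Rd(1)] by simp
  have "\<exists>j<d. j \<notin> R"
  proof (rule ccontr)
    assume "\<not> (\<exists>j<d. j \<notin> R)"
    then have "R = {..<d}" using Rd by auto
    then show False using Rd \<open>r < d\<close> by simp
  qed
  then obtain j where j: "j < d" "j \<notin> R" by auto
  have "consistent d n D S P \<and> S \<subseteq> {..<d} \<and> card S \<le> nat (\<lceil>real r\<rceil> + 1) \<and>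
    (R \<subseteq> S \<or> S \<subseteq> R \<and> card S = nat (\<lceil>real r\<rceil> + 1))"
  proof (rule level_split_invariant[OF \<open>d > 0\<close> _ _ _ PS, where J = "\<lambda>k S. R \<subseteq> S \<or> S \<subseteq> R \<and> card S = k"])
    fix k S i
    assume IH: "R \<subseteq> S \<or> S \<subseteq> R \<and> card S = k"
      and S: "S \<subseteq> {..<d}" "card S \<le> k" "k < nat (\<lceil>real r\<rceil> + 1)" and i: "i \<in> best_splits d n D S"
    have id: "i < d" using i by (simp add: best_splits_def)
    show "R \<subseteq> insert i S \<or> insert i S \<subseteq> R \<and> card (insert i S) = Suc k"
    proof (cases "R \<subseteq> S")
      case False
      then have SR: "S \<subseteq> R" "card S = k" using IH by auto
      obtain l where l: "l \<in> R" "l \<notin> S" using False by auto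
      \<comment> \<open>Strictness asks for a feature other than l outside \<open>S\<close>; the
        irrelevant j, which exists because r < d, is one.\<close>
      have T: "S \<subset> {..<d} - {l}" using SR l j Rd by auto
      have best: "gap (insert i S) \<le> gap (insert l S) + 18 * err (r + 1) \<eta>"
        using best_split_gap[OF good n S(1) _ i, of l] S s l Rd by auto
      have "i \<in> R - S"
      proof (rule ccontr)
        assume "i \<notin> R - S"
        then consider "i \<in> S" | "i \<notin> R" by auto
        then show False
        proof cases
          \<comment> \<open>A repeated pick is relevant, so the hypothesis does not compare it with
            l directly. It leaves the gap at \<open>gap S\<close>, which is at least the gap after
            adding j, and j is compared with l.\<close>
          case 1
          then have "gap (insert j S) \<le> gap (insert i S)"
            using gap_antimono[OF subset_insertI[of S j]] S j by (auto simp: insert_absorb)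
          then show False using strong[OF l(1) j T] best \<beta> by simp
        next
          case 2
          then show False using strong[OF l(1) id 2 T] best \<beta> by simp
        qed
      qed
      then show ?thesis using SR finite_subset[OF SR(1) fin] by auto
    qed auto
  qed auto
  moreover have "\<not> (S \<subseteq> R \<and> card S = r + 1)"
    using card_mono[OF fin, of S] Rd by auto
  ultimately show ?thesis unfolding s using gap_relevant[OF R, of S] by blast
qed

text \<open>The value of \<eta> for which the union bound closes: ln (12/\<delta>) and ln (2 d) are
  each at most 4 log (d/\<delta>), hence 4 (s + 1).\<close>

definition rate :: "nat \<Rightarrow> nat \<Rightarrow> real \<Rightarrow> real" where
  "rate n s \<delta> = 4 * (real s + 1) * log 2 (d / \<delta>) / n"

lemma rate_pos:
  assumes "n > 0" "0 < \<delta>" "d / \<delta> \<ge> 2"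
  shows "rate n s \<delta> > 0"
proof -
  have "0 < log 2 (d / \<delta>)" using assms by (subst zero_less_log_cancel_iff) linarith+
  then show ?thesis using assms by (simp add: rate_def)
qed

text \<open>The probabilistic part ends here: each claim is reduced to one good sample and one
  possible run.\<close>

lemma prob_mse_exceeds_le_if_good:
  assumes n: "n > 0" and \<delta>: "0 < \<delta>" "\<delta> < 1" and d2: "d / \<delta> \<ge> 2"
    and mse: "\<And>D P S. good_sample n s (rate n s \<delta>) D \<Longrightarrow> (P, S) \<in> set_pmf (level_split d n logt D) \<Longrightarrow>
           mse Dx m (estimator n D P) \<le> \<tau>"
  shows "prob_mse_exceeds d n logt Dx E m \<tau> \<le> \<delta>"
proof -
  let ?L = "log 2 (d / \<delta>)"
  have d: "d > 0" using d2 \<delta> by (intro Nat.gr0I) auto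
  have L: "?L \<ge> 1" using d2 \<delta> d by (simp add: le_log_iff)
  \<comment> \<open>Both binary logarithms below are at most 5 log (d/\<delta>), using log
    (d/\<delta>) \<ge> 1; the factor 4/5, which is above ln 2, reduces 5 to 4.\<close>
  have ln_le: "ln x \<le> 4 / 5 * y" if "log 2 x \<le> y" "0 \<le> y" for x y :: real
  proof -
    have "ln x = ln 2 * log 2 x" by (simp add: log_def)
    also have "\<dots> \<le> ln 2 * y" using that by (intro mult_left_mono) auto
    also have "\<dots> \<le> 4 / 5 * y" using that ln2_le_25_over_36 by (intro mult_right_mono) auto
    finally show ?thesis .
  qed
  have "log 2 (12 / \<delta>) \<le> log 2 (16 * (d / \<delta>))"
    using d \<delta> by (intro log_mono) (auto simp: field_simps)
  also have "\<dots> = log 2 16 + ?L" using d \<delta> by (intro log_mult_pos) auto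
  also have "log 2 16 = (4 :: real)" using log_pow_cancel[of 2 4] by simp
  finally have "log 2 (12 / \<delta>) \<le> 5 * ?L" using L by linarith
  then have a: "ln (12 / \<delta>) \<le> 4 * ?L" using ln_le[of "12 / \<delta>" "5 * ?L"] L by simp
  have "log 2 (2 * d) \<le> log 2 (2 * (d / \<delta>))"
    using d \<delta> by (intro log_mono) (auto simp: field_simps)
  also have "\<dots> = log 2 2 + ?L" using d \<delta> by (intro log_mult_pos) auto
  finally have "log 2 (2 * d) \<le> 5 * ?L" using L by simp
  then have b: "ln (2 * d) \<le> 4 * ?L" using ln_le[of "2 * d" "5 * ?L"] L by simp
  have "ln (12 / \<delta>) + s * ln (2 * d) \<le> 4 * ?L + s * (4 * ?L)"
    using a b by (intro add_mono mult_left_mono) auto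
  also have "\<dots> = n * rate n s \<delta>" using n by (simp add: rate_def field_simps)
  finally obtain B where B: "B \<in> sets (sample_law n Dx E m)" "measure (sample_law n Dx E m) B \<le> \<delta>"
      "AE D in sample_law n Dx E m. D \<notin> B \<longrightarrow> good_sample n s (rate n s \<delta>) D"
    using good_sample_prob[OF d n rate_pos[OF n \<delta>(1) d2] \<delta>(1)] by blast
  show ?thesis
  proof (rule prob_mse_exceeds_le[OF B(1,2)])
    show "AE D in sample_law n Dx E m. D \<notin> B \<longrightarrow>
        (\<forall>(P, S)\<in>set_pmf (level_split d n logt D). mse Dx m (estimator n D P) \<le> \<tau>)"
      using B(3) by eventually_elim (use mse in auto)
  qed
qed

section \<open>Rates\<close>

lemma rate_conv:
  "2 ^ (r + 1) * rate n (r + 1) \<delta> = 8 * (real r + 2) * (2 ^ r * log 2 (d / \<delta>) / n)"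
  by (simp add: rate_def)

text \<open>The input balances bias and estimation. Write a = C r, L = log (d/\<delta>), q = log (n
  / L), and \<rho> for the claimed power of L / n. About a q / (a + 2) splits make the bias (1 -
  1/a)^s at most \<rho> and 2^s \<eta> of order \<rho>^2 up to logarithms, so its square root is
  again of order \<rho>.\<close>

lemma prob_mse_exceeds_submodular:
  assumes n: "n \<ge> 1" and \<delta>: "0 < \<delta>" "\<delta> < 1" and d2: "d / \<delta> \<ge> 2" and C: "C \<ge> 1"
    and sub: "approx_submodular d C (Vbar Dx m)" and sparse: "r_sparse d r m" and r: "r \<ge> 1"
  shows "prob_mse_exceeds d n (C * r / (C * r + 2) * (log 2 n - log 2 (log 2 (d / \<delta>)))) Dx E m
     (Omega_tilde 4000 1 [n, 2 ^ r, C] (C * r * (log 2 (d / \<delta>) / n) powr (1 / (C * r + 2)))) \<le> \<delta>"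
    (is "prob_mse_exceeds d n ?logt Dx E m ?\<tau> \<le> \<delta>")
proof -
  have d: "d > 0" using d2 by (intro Nat.gr0I) auto
  have "n > 0" using n by simp
  define L where "L = log 2 (d / \<delta>)"
  define a where "a = C * r"
  define \<rho> where "\<rho> = (L / n) powr (1 / (a + 2))"
  define F where "F = size_factor n r C"
  have L: "1 \<le> L" unfolding L_def using d2 by (subst one_le_log_cancel_iff) linarith+
  have a: "1 \<le> a" using C r mult_mono[of 1 C 1 "real r"] by (simp add: a_def)
  have F: "1 \<le> F" "log 2 n + 1 \<le> F" using size_factor_bounds[of n C r] n C by (auto simp: F_def)
  have \<rho>: "0 < \<rho>" using L n by (simp add: \<rho>_def)
  have \<tau>: "?\<tau> = 4000 * (a * \<rho>) * F"
    by (simp add: Omega_tilde_conv F_def \<rho>_def a_def L_def)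
  show ?thesis
  proof (cases "L \<le> n")
    \<comment> \<open>Here the input is negative and \<rho> \<ge> 1, so the threshold is at least
      4000 and the trivial bound suffices.\<close>
    case False
    show ?thesis
    proof (rule prob_mse_exceeds_le_if_good[OF \<open>n > 0\<close> \<delta> d2])
      fix D P S assume good: "good_sample n 0 (rate n 0 \<delta>) D"
      have "1 \<le> \<rho>" unfolding \<rho>_def using False n a by (intro ge_one_powr_ge_zero) auto
      then have "4000 * (1 * 1) * 1 \<le> ?\<tau>" unfolding \<tau> using a F by (intro mult_mono) auto
      then show "mse Dx m (estimator n D P) \<le> ?\<tau>" using mse_estimator_le[OF good, of P] by linarith
    qed
  next
    case True
    define q where "q = log 2 (n / L)"
    define s where "s = nat (\<lceil>?logt\<rceil> + 1)"
    have q: "0 \<le> q" "q \<le> log 2 n"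
      using True L n by (auto simp: q_def divide_le_eq intro!: log_mono)
    have nL: "2 powr q = n / L" using L n by (simp add: q_def)
    have logt: "?logt = a / (a + 2) * q"
      using L n by (simp add: q_def a_def L_def log_divide_pos)
    have logt0: "0 \<le> ?logt" unfolding logt using a q by simp
    have "a / (a + 2) * q \<le> 1 * q" using a q by (intro mult_right_mono) auto
    then have logtq: "?logt \<le> log 2 n" unfolding logt using q by simp
    have s_up: "real s \<le> ?logt + 2" and s_low: "?logt \<le> real s"
      unfolding s_def using logt0 by linarith+
    have \<rho>q: "\<rho> = 2 powr (- q / (a + 2))"
    proof -
      have "L / n = 2 powr (- q)" using nL L n by (simp add: powr_minus field_simps)
      then show ?thesis by (simp add: \<rho>_def powr_powr)
    qed
    have \<rho>1: "\<rho> \<le> 1"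
    proof -
      have "2 powr (- q / (a + 2)) \<le> 2 powr 0" using q a by (intro powr_mono) auto
      then show ?thesis by (simp add: \<rho>q)
    qed
    note \<eta> = rate_pos[OF \<open>n > 0\<close> \<delta>(1) d2, of s]
    define x where "x = 2 ^ s * rate n s \<delta>"
    have x0: "x > 0" using \<eta> by (simp add: x_def)
    \<comment> \<open>48 is 4 from rounding, as s is at most the input plus 2, times 4 from
      \<open>rate\<close>, times 3 from s + 1 \<le> 3 F.\<close>
    have x_le: "x \<le> 48 * F * \<rho>\<^sup>2"
    proof -
      have "2 ^ s = 2 powr real s" by (simp add: powr_realpow)
      also have "\<dots> \<le> 2 powr (a / (a + 2) * q + 2)" using s_up logt by (intro powr_mono) auto
      also have "\<dots> = 4 * 2 powr (a / (a + 2) * q)" by (simp add: powr_add)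
      finally have two: "2 ^ s \<le> 4 * 2 powr (a / (a + 2) * q)" .
      have "real s + 1 \<le> 3 * F" using s_up logtq F by linarith
      then have "rate n s \<delta> \<le> 4 * (3 * F) * (L / n)"
        unfolding rate_def L_def[symmetric] using L by (simp add: divide_right_mono mult_right_mono)
      also have "L / n = 2 powr (- q)" using nL L n by (simp add: powr_minus field_simps)
      finally have "x \<le> (4 * 2 powr (a / (a + 2) * q)) * (4 * (3 * F) * 2 powr (- q))"
        unfolding x_def using two \<eta> by (intro mult_mono) auto
      also have "\<dots> = 48 * F * 2 powr (a / (a + 2) * q + - q)"
        by (simp only: powr_add) simp
      also have "a / (a + 2) * q + - q = - q / (a + 2) + - q / (a + 2)"
      proof -
        have "a / (a + 2) = 1 - 2 / (a + 2)" using a by (simp add: field_simps)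
        then have "a / (a + 2) * q = (1 - 2 / (a + 2)) * q" by (rule arg_cong)
        then show ?thesis by (simp add: left_diff_distrib)
      qed
      also have "2 powr \<dots> = \<rho>\<^sup>2" by (simp only: powr_add \<rho>q power2_eq_square)
      finally show ?thesis .
    qed
    have err: "sqrt x \<le> 7 * F * \<rho>"
    proof -
      have "48 * F * \<rho>\<^sup>2 \<le> (49 * F * F) * \<rho>\<^sup>2"
        using F by (intro mult_right_mono mult_mono) auto
      then have "x \<le> (7 * F * \<rho>)\<^sup>2" using x_le by (simp add: power2_eq_square algebra_simps)
      then show ?thesis using F \<rho> by (intro real_le_lsqrt) (use x0 in auto)
    qed
    have aF\<rho>: "F * \<rho> \<le> a * (F * \<rho>)" using mult_right_mono[of 1 a "F * \<rho>"] a F \<rho> by simp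
    obtain R where R: "relevant_features d r m R" using sparse by (auto simp: r_sparse_def)
    show ?thesis
    proof (rule prob_mse_exceeds_le_if_good[OF \<open>n > 0\<close> \<delta> d2])
      fix D P S
      assume good: "good_sample n s (rate n s \<delta>) D" and PS: "(P, S) \<in> set_pmf (level_split d n ?logt D)"
      have "mse Dx m (estimator n D P) \<le> 4000 * (a * (F * \<rho>))"
      proof (cases "x \<le> 1")
        case True
        have cons: "consistent d n D S P" "S \<subseteq> {..<d}" "card S \<le> s"
          and gap: "gap S \<le> (1 - 1 / a) ^ s / 4 + 18 * a * sqrt x"
          using gap_greedy[OF good \<open>n > 0\<close> \<eta> True[unfolded x_def] R sub C r d logt0 s_def PS]
          by (auto simp: err_def x_def a_def)
        \<comment> \<open>Since s \<ge> a q / (a + 2), the bias is at most exp (- q / (a + 2));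
          weakening the base from e to 2 gives \<rho>.\<close>
        have "(1 - 1 / a) ^ s \<le> exp (- (1 / a)) ^ s"
          using a exp_ge_add_one_self[of "- (1 / a)"] by (intro power_mono) auto
        also have "\<dots> = exp (- (real s / a))" by (simp flip: exp_of_nat_mult)
        also have "\<dots> \<le> exp (- (q / (a + 2)) * ln 2)"
        proof -
          have "q / (a + 2) * ln 2 \<le> q / (a + 2) * 1"
            using q a ln2_le_25_over_36 by (intro mult_left_mono) auto
          also have "\<dots> = (a / (a + 2) * q) / a" using a by simp
          also have "\<dots> \<le> real s / a" using s_low logt a by (intro divide_right_mono) auto
          finally show ?thesis by simp
        qed
        also have "\<dots> = \<rho>" by (simp add: \<rho>q powr_def)
        finally have bias: "(1 - 1 / a) ^ s \<le> \<rho>" .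
        have "mse Dx m (estimator n D P) \<le> gap S + 72 * x"
          unfolding x_def by (rule mse_estimator_le_gap[OF good \<open>n > 0\<close> \<eta> cons])
        also have "\<dots> \<le> (\<rho> / 4 + 18 * a * (7 * F * \<rho>)) + 72 * (48 * F * \<rho>)"
        proof (intro add_mono order_trans[OF gap] mult_left_mono)
          have "\<rho>\<^sup>2 \<le> \<rho>" using \<rho> \<rho>1 by (simp add: power2_eq_square mult_left_le_one_le)
          then show "x \<le> 48 * F * \<rho>" using F by (intro order_trans[OF x_le] mult_left_mono) auto
        qed (use bias err a in auto)
        \<comment> \<open>The coefficients 1/4, 126 = 18 * 7 and 3456 = 72 * 48 add up to less than
          4000.\<close>
        also have "\<dots> \<le> 4000 * (a * (F * \<rho>))"
        proof -
          have "\<rho> \<le> F * \<rho>" using F \<rho> by simp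
          moreover have "(\<rho> / 4 + 18 * a * (7 * F * \<rho>)) + 72 * (48 * F * \<rho>)
              = \<rho> / 4 + 126 * (a * (F * \<rho>)) + 3456 * (F * \<rho>)" by simp
          ultimately show ?thesis using aF\<rho> \<rho> by linarith
        qed
        finally show ?thesis .
      next
        case False
        then have "1 \<le> 7 * F * \<rho>" using err by (intro order_trans[OF _ err]) auto
        then show ?thesis using mse_estimator_le[OF good, of P] aF\<rho> by linarith
      qed
      then show "mse Dx m (estimator n D P) \<le> ?\<tau>" unfolding \<tau> by (simp add: algebra_simps)
    qed
  qed
qed

text \<open>The logarithmic factor enters twice, hence the exponent 2: through the r in the gap
  bound and through the r + 2 in \<open>rate\<close>.\<close>

lemma prob_mse_exceeds_independent:
  assumes n: "n \<ge> 1" and \<delta>: "0 < \<delta>" "\<delta> < 1" and d2: "d / \<delta> \<ge> 2" and C: "C \<ge> 1"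
    and sub: "approx_submodular d C (Vbar Dx m)" and indep: "independent_features d Dx"
    and sparse: "r_sparse d r m"
  shows "prob_mse_exceeds d n r Dx E m
     (Omega_tilde 400 2 [n, 2 ^ r, C] (C * sqrt (2 ^ r * log 2 (d / \<delta>) / n))) \<le> \<delta>"
proof (rule prob_mse_exceeds_le_if_good[OF _ \<delta> d2])
  show "n > 0" using n by simp
  fix D P S
  assume good: "good_sample n (r + 1) (rate n (r + 1) \<delta>) D"
    and PS: "(P, S) \<in> set_pmf (level_split d n (real r) D)"
  have d: "d > 0" using d2 by (intro Nat.gr0I) auto
  obtain R where R: "relevant_features d r m R" using sparse by (auto simp: r_sparse_def)
  define F where "F = size_factor n r C"
  define B where "B = 2 ^ r * log 2 (d / \<delta>) / n"
  define x where "x = 2 ^ (r + 1) * rate n (r + 1) \<delta>"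
  note \<eta> = rate_pos[OF \<open>n > 0\<close> \<delta>(1) d2, of "r + 1"]
  have F: "1 \<le> F" "real r + 1 \<le> F" using size_factor_bounds[of n C r] n C by (auto simp: F_def)
  have "0 < log 2 (d / \<delta>)" using d2 by (subst zero_less_log_cancel_iff) linarith+
  then have B: "B > 0" using n by (simp add: B_def)
  have x0: "x > 0" using \<eta> by (simp add: x_def)
  have "x = 8 * (real r + 2) * B" unfolding x_def B_def by (rule rate_conv)
  also have "\<dots> \<le> 16 * F * B" using F B by (intro mult_right_mono) auto
  also have "\<dots> \<le> (4 * F)\<^sup>2 * B" using F B by (simp add: power2_eq_square mult_right_mono)
  finally have "sqrt x \<le> sqrt ((4 * F)\<^sup>2 * B)" by simp
  also have "\<dots> = 4 * F * sqrt B" using F by (simp add: real_sqrt_mult)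
  finally have err: "sqrt x \<le> 4 * F * sqrt B" .
  \<comment> \<open>90 = 18 + 72: the gap, and the leaf error by x \<le> sqrt x on the unit
    interval.\<close>
  have "mse Dx m (estimator n D P) \<le> 90 * (C * F) * sqrt x"
  proof (cases "x \<le> 1")
    case True
    have cons: "consistent d n D S P" "S \<subseteq> {..<d}" "card S \<le> r + 1"
      and gap: "gap S \<le> C * r * (18 * sqrt x)"
      using gap_greedy_independent[OF good \<open>n > 0\<close> \<eta> True[unfolded x_def] R sub C indep d PS]
      by (auto simp: err_def x_def)
    have "mse Dx m (estimator n D P) \<le> gap S + 72 * x"
      unfolding x_def by (rule mse_estimator_le_gap[OF good \<open>n > 0\<close> \<eta> cons])
    also have "gap S \<le> C * F * (18 * sqrt x)"
      using F C x0 by (intro order_trans[OF gap] mult_right_mono mult_left_mono) auto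
    also have "72 * x \<le> 72 * (1 * sqrt x)" using True x0 le_sqrt_self[of x] by simp
    also have "\<dots> \<le> 72 * (C * F * sqrt x)"
      using F C x0 mult_mono[of 1 C 1 F] by (intro mult_left_mono mult_right_mono) auto
    finally show ?thesis by simp
  next
    case False
    have "mse Dx m (estimator n D P) \<le> 9 / 4" by (rule mse_estimator_le[OF good])
    also have "\<dots> \<le> 90 * 1 * 1" by simp
    also have "\<dots> \<le> 90 * (C * F) * sqrt x"
      using F C False mult_mono[of 1 C 1 F] by (intro mult_mono) auto
    finally show ?thesis .
  qed
  also have "\<dots> \<le> 90 * (C * F) * (4 * F * sqrt B)"
    using F C by (intro mult_left_mono err) auto
  also have "\<dots> \<le> 400 * (C * sqrt B) * F\<^sup>2"
    using F C B by (simp add: power2_eq_square algebra_simps)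
  finally show "mse Dx m (estimator n D P)
      \<le> Omega_tilde 400 2 [n, 2 ^ r, C] (C * sqrt (2 ^ r * log 2 (d / \<delta>) / n))"
    by (simp add: Omega_tilde_conv F_def B_def)
qed

lemma prob_mse_exceeds_strongly_sparse:
  assumes n: "n \<ge> 1" and \<delta>: "0 < \<delta>" "\<delta> < 1" and d2: "d / \<delta> \<ge> 2" and \<beta>: "0 < \<beta>" "\<beta> \<le> 1"
    and "r < d" and sparse: "strongly_sparse d \<beta> r Dx m"
    and large: "n \<ge> Omega_tilde 10000 1 [n, 2 ^ r, 1 / \<beta>] (2 ^ r * log 2 (d / \<delta>) / \<beta>\<^sup>2)"
  shows "prob_mse_exceeds d n r Dx E m
     (Omega_tilde 1152 1 [n, 2 ^ r, 1 / \<beta>] (2 ^ r * log 2 (d / \<delta>) * log 2 n / n)) \<le> \<delta>"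
proof (rule prob_mse_exceeds_le_if_good[OF _ \<delta> d2])
  show "n > 0" using n by simp
  fix D P S
  assume good: "good_sample n (r + 1) (rate n (r + 1) \<delta>) D"
    and PS: "(P, S) \<in> set_pmf (level_split d n (real r) D)"
  define F where "F = size_factor n r (1 / \<beta>)"
  define B where "B = 2 ^ r * log 2 (d / \<delta>) / n"
  define x where "x = 2 ^ (r + 1) * rate n (r + 1) \<delta>"
  note \<eta> = rate_pos[OF \<open>n > 0\<close> \<delta>(1) d2, of "r + 1"]
  have F: "1 \<le> F" "real r + 1 \<le> F" using size_factor_bounds[of n "1 / \<beta>" r] n \<beta> by (auto simp: F_def)
  have L: "1 \<le> log 2 (d / \<delta>)" using d2 by (subst one_le_log_cancel_iff) linarith+
  then have B: "B > 0" using n by (simp add: B_def)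
  have x0: "x > 0" using \<eta> by (simp add: x_def)
  have large': "n * \<beta>\<^sup>2 \<ge> 10000 * (2 ^ r * log 2 (d / \<delta>)) * F"
    using large \<beta> by (simp add: Omega_tilde_conv F_def field_simps)
  then have FB: "10000 * (F * B) \<le> \<beta>\<^sup>2" using n by (simp add: B_def field_simps)
  have "x = 8 * (real r + 2) * B" unfolding x_def B_def by (rule rate_conv)
  also have "\<dots> \<le> 16 * F * B" using F B by (intro mult_right_mono) auto
  finally have x: "x \<le> 16 * (F * B)" by simp
  have "\<beta>\<^sup>2 \<le> 1" using \<beta> by (simp add: power_le_one)
  then have x1: "x \<le> 1" using x FB by linarith
  \<comment> \<open>10000 = 16 * 625 is what makes x at most (\<beta> / 25)^2, and 18/25 < 1 keeps
    the comparison error below \<beta>.\<close>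
  have "x \<le> (\<beta> / 25)\<^sup>2" using x FB by (simp add: power_divide)
  then have "sqrt x \<le> \<beta> / 25" using \<beta> by (intro real_le_lsqrt) (use x0 in auto)
  then have err: "18 * err (r + 1) (rate n (r + 1) \<delta>) < \<beta>"
    using \<beta> by (simp add: err_def x_def)
  have cons: "consistent d n D S P" "S \<subseteq> {..<d}" "card S \<le> r + 1" and gap: "gap S = 0"
    using gap_greedy_strongly_sparse[OF good \<open>n > 0\<close> \<eta> x1[unfolded x_def] sparse err \<open>r < d\<close> PS] by auto
  have "1 * 1 * 1 \<le> 2 ^ r * log 2 (d / \<delta>) * F" using L F by (intro mult_mono) auto
  then have "10000 \<le> n * \<beta>\<^sup>2" using large' by (simp add: mult.assoc)
  also have "\<dots> \<le> real n * 1" using \<open>\<beta>\<^sup>2 \<le> 1\<close> by (intro mult_left_mono) auto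
  finally have logn: "1 \<le> log 2 n" by (subst one_le_log_cancel_iff) auto
  have "mse Dx m (estimator n D P) \<le> gap S + 72 * x"
    unfolding x_def by (rule mse_estimator_le_gap[OF good \<open>n > 0\<close> \<eta> cons])
  \<comment> \<open>Only the second-order error remains: 1152 = 72 * 16.\<close>
  also have "\<dots> \<le> 1152 * (F * B) * 1" using gap x by linarith
  also have "\<dots> \<le> 1152 * (F * B) * log 2 n" using logn F B by (intro mult_left_mono) auto
  finally show "mse Dx m (estimator n D P)
      \<le> Omega_tilde 1152 1 [n, 2 ^ r, 1 / \<beta>] (2 ^ r * log 2 (d / \<delta>) * log 2 n / n)"
    by (simp add: Omega_tilde_conv F_def B_def algebra_simps)
qed

end

theorem theorem3p3:
  shows
    "(\<exists>K p. K > 0 \<and>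
       (\<forall>(d::nat) (n::nat) (r::nat). \<forall>(C::real) \<delta>::real. \<forall>Dx E m.
          regression_model d Dx E m \<and> n \<ge> 1 \<and> 0 < \<delta> \<and> \<delta> < 1 \<and> real d / \<delta> \<ge> 2 \<and>
          C \<ge> 1 \<and> approx_submodular d C (Vbar Dx m) \<and> r_sparse d r m \<and> r \<ge> 1 \<longrightarrow>
          prob_mse_exceeds d n (C * real r / (C * real r + 2) * (log 2 n - log 2 (log 2 (real d / \<delta>)))) Dx E m
            (Omega_tilde K p [n, 2 ^ r, C]
               (C * real r * (log 2 (real d / \<delta>) / n) powr (1 / (C * real r + 2)))) \<le> \<delta>))
     \<and>
     (\<exists>K p. K > 0 \<and>
       (\<forall>(d::nat) (n::nat) (r::nat). \<forall>(C::real) \<delta>::real. \<forall>Dx E m.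
          regression_model d Dx E m \<and> n \<ge> 1 \<and> 0 < \<delta> \<and> \<delta> < 1 \<and> real d / \<delta> \<ge> 2 \<and>
          C \<ge> 1 \<and> approx_submodular d C (Vbar Dx m) \<and> independent_features d Dx \<and>
          r_sparse d r m \<longrightarrow>
          prob_mse_exceeds d n r Dx E m
            (Omega_tilde K p [n, 2 ^ r, C]
               (C * sqrt (2 ^ r * log 2 (real d / \<delta>) / n))) \<le> \<delta>))
     \<and>
     (\<exists>K p K' p'. K > 0 \<and> K' > 0 \<and>
       (\<forall>(d::nat) (n::nat) (r::nat). \<forall>(\<beta>::real) \<delta>::real. \<forall>Dx E m.
          regression_model d Dx E m \<and> n \<ge> 1 \<and> 0 < \<delta> \<and> \<delta> < 1 \<and> real d / \<delta> \<ge> 2 \<and>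
          0 < \<beta> \<and> \<beta> \<le> 1 \<and> r < d \<and> strongly_sparse d \<beta> r Dx m \<and>
          n \<ge> Omega_tilde K' p' [n, 2 ^ r, 1 / \<beta>] (2 ^ r * log 2 (real d / \<delta>) / \<beta>\<^sup>2) \<longrightarrow>
          prob_mse_exceeds d n r Dx E m
            (Omega_tilde K p [n, 2 ^ r, 1 / \<beta>]
               (2 ^ r * log 2 (real d / \<delta>) * log 2 n / n)) \<le> \<delta>))"
proof (intro conjI, goal_cases)
  case 1
  show ?case
    by (intro exI[of _ 4000] exI[of _ 1] conjI allI impI)
       (simp, elim conjE, rule regression.prob_mse_exceeds_submodular[OF regression.intro])
next
  case 2
  show ?case
    by (intro exI[of _ 400] exI[of _ 2] conjI allI impI)
       (simp, elim conjE, rule regression.prob_mse_exceeds_independent[OF regression.intro])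
next
  case 3
  show ?case
    by (rule exI[of _ 1152], rule exI[of _ 1], rule exI[of _ 10000], rule exI[of _ 1], intro conjI allI impI)
       (simp, simp, elim conjE, rule regression.prob_mse_exceeds_strongly_sparse[OF regression.intro])
qed

end
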